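(* If $p\in(1,2]$, then the open unit ball $B_{\ell_p}$ of the complex Banach space $\ell_p$ is $1$-uniformly pseudoconvex.
   Context: $bU$ denotes the boundary of $U$. A $C^\ell$ defining function of $bU$ is a real-valued $r\in C^\ell(V)$ on a neighborhood $V$ of $bU$ such that $U\cap V=\{z\in V:r(z)<0\}$ and $Dr(w)\ne0$ for all $w\in bU$ ($D$ is the Fréchet derivative). For $V$ open in a complex Banach space $X$, an upper semicontinuous $g:V\to[-\infty,\infty)$ is uniformly plurisubharmonic on average if there exist a constant $L>0$ and a lower semicontinuous $\delta:V\to(0,\infty)$ such that for all $a\in V$ and $b\in X$ with $\|b\|<\delta(a)$ (where $\delta(a)$ is small enough that the closed disk $a+\overline{\mathbb{D}}b$ lies in $V$), $$L\|b\|^2+g(a)\le\frac1{2\pi}\int_0^{2\pi}g(a+e^{i\theta}b)\,d\theta.$$ For $\ell\ge1$, a bounded open domain $U$ in a Banach space $X$ is $\ell$-uniformly pseudoconvex if it admits a $C^\ell$ defining function of $bU$ (on some neighborhood $V$ of $bU$) which is uniformly plurisubharmonic on average on its domain $V$. *)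

theory Defs
  imports "HOL-Analysis.Analysis" "HOL-Library.Function_Algebras"
begin

section \<open>Complex Banach spaces on an explicit carrier\<close>

text \<open>
  The space \<open>\<ell>\<^sub>p\<close> depends on a real parameter and therefore cannot be a type. A complex normed
  space is given by a subspace \<open>X\<close> of a complex vector space with a norm on \<open>X\<close>; the
  values of the norm outside \<open>X\<close> are irrelevant.
\<close>

locale complex_normed_space = vector_space scale
  for scale :: "complex \<Rightarrow> 'a::ab_group_add \<Rightarrow> 'a" (infixr "\<cdot>" 75) +
  fixes X :: "'a set" and nrm :: "'a \<Rightarrow> real"
  assumes subspace_carrier: "subspace X"
    and nrm_nonneg: "x \<in> X \<Longrightarrow> 0 \<le> nrm x"
    and nrm_eq_0: "x \<in> X \<Longrightarrow> nrm x = 0 \<longleftrightarrow> x = 0"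
    and nrm_triangle: "x \<in> X \<Longrightarrow> y \<in> X \<Longrightarrow> nrm (x + y) \<le> nrm x + nrm y"
    and nrm_scale: "x \<in> X \<Longrightarrow> nrm (c \<cdot> x) = cmod c * nrm x"
begin

text \<open>The locale \<^locale>\<open>Metric_space\<close> requires symmetry and nonnegativity also outside the carrier.\<close>

definition ndist :: "'a \<Rightarrow> 'a \<Rightarrow> real" where
  "ndist x y = (if x \<in> X \<and> y \<in> X then nrm (x - y) else 0)"

sublocale metric: Metric_space X ndist
proof
  have diff: "x - y \<in> X" if "x \<in> X" "y \<in> X" for x y
    using that subspace_carrier by (rule_tac subspace_diff)
  show "0 \<le> ndist x y" for x y
    by (simp add: ndist_def nrm_nonneg diff)
  show "ndist x y = ndist y x" for x y
    using nrm_scale[of "x - y" "- 1"] by (auto simp: ndist_def diff)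
  show "ndist x y = 0 \<longleftrightarrow> x = y" if "x \<in> X" "y \<in> X" for x y
    using that by (simp add: ndist_def diff nrm_eq_0)
  show "ndist x z \<le> ndist x y + ndist y z" if "x \<in> X" "y \<in> X" "z \<in> X" for x y z
    using that nrm_triangle[of "x - y" "y - z"] by (simp add: ndist_def diff)
qed

definition open_unit_ball :: "'a set" where
  "open_unit_ball = {x \<in> X. nrm x < 1}"

subsection \<open>Frechet derivatives and the classes \<open>C\<^sup>k\<close>\<close>

text \<open>
  Real derivatives of real-valued functions. A \<open>k\<close>-linear form on \<open>X\<close> is a function of
  argument lists of length \<open>k\<close>; for \<open>k = 0\<close> it is a constant.
\<close>

definition bounded_multilinear :: "nat \<Rightarrow> ('a list \<Rightarrow> real) \<Rightarrow> bool" where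
  "bounded_multilinear k T \<longleftrightarrow>
     (\<forall>us vs. set us \<subseteq> X \<longrightarrow> set vs \<subseteq> X \<longrightarrow> Suc (length us + length vs) = k \<longrightarrow>
        (\<forall>x\<in>X. \<forall>y\<in>X. \<forall>s t :: real.
           T (us @ (of_real s \<cdot> x + of_real t \<cdot> y) # vs) = s * T (us @ x # vs) + t * T (us @ y # vs))) \<and>
     (\<exists>C. \<forall>hs\<in>lists X. length hs = k \<longrightarrow> \<bar>T hs\<bar> \<le> C * prod_list (map nrm hs))"

definition has_frechet_derivative :: "('a \<Rightarrow> real) \<Rightarrow> ('a \<Rightarrow> real) \<Rightarrow> 'a \<Rightarrow> bool" where
  "has_frechet_derivative f T x \<longleftrightarrow>
     (\<forall>u\<in>X. \<forall>v\<in>X. \<forall>s t :: real. T (of_real s \<cdot> u + of_real t \<cdot> v) = s * T u + t * T v) \<and>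
     (\<exists>C. \<forall>h\<in>X. \<bar>T h\<bar> \<le> C * nrm h) \<and>
     ((\<lambda>y. (f y - f x - T (y - x)) / nrm (y - x)) \<longlongrightarrow> 0) (atin metric.mtopology x)"

text \<open>
  In \<open>C_on l V f\<close> the witness \<open>D k x\<close> is the \<open>k\<close>-th derivative of \<open>f\<close> at \<open>x\<close>; the third and the
  fourth conjunct are Frechet differentiability and continuity of \<open>D k\<close> in the operator norm.
\<close>

definition C_on :: "nat \<Rightarrow> 'a set \<Rightarrow> ('a \<Rightarrow> real) \<Rightarrow> bool" where
  "C_on l V f \<longleftrightarrow>
     (\<exists>D :: nat \<Rightarrow> 'a \<Rightarrow> 'a list \<Rightarrow> real.
        (\<forall>x\<in>V. D 0 x [] = f x) \<and>
        (\<forall>k\<le>l. \<forall>x\<in>V. bounded_multilinear k (D k x)) \<and>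
        (\<forall>k<l. \<forall>x\<in>V. \<forall>\<epsilon>>0. \<forall>\<^sub>F y in atin metric.mtopology x. \<forall>hs\<in>lists X. length hs = k \<longrightarrow>
           \<bar>D k y hs - D k x hs - D (Suc k) x ((y - x) # hs)\<bar>
             \<le> \<epsilon> * nrm (y - x) * prod_list (map nrm hs)) \<and>
        (\<forall>k\<le>l. \<forall>x\<in>V. \<forall>\<epsilon>>0. \<forall>\<^sub>F y in atin metric.mtopology x. \<forall>hs\<in>lists X. length hs = k \<longrightarrow>
           \<bar>D k y hs - D k x hs\<bar> \<le> \<epsilon> * prod_list (map nrm hs)))"

text \<open>\<open>r\<close> is a defining function, on the open neighbourhood \<open>V\<close>, of the boundary of \<open>U\<close>.\<close>

definition defining_function :: "nat \<Rightarrow> 'a set \<Rightarrow> 'a set \<Rightarrow> ('a \<Rightarrow> real) \<Rightarrow> bool" where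
  "defining_function l U V r \<longleftrightarrow>
     openin metric.mtopology V \<and> metric.mtopology frontier_of U \<subseteq> V \<and>
     C_on l V r \<and>
     U \<inter> V = {z \<in> V. r z < 0} \<and>
     (\<forall>w \<in> metric.mtopology frontier_of U. \<exists>T. has_frechet_derivative r T w \<and> (\<exists>h\<in>X. T h \<noteq> 0))"

end

subsection \<open>Uniform plurisubharmonicity on average\<close>

text \<open>
  The mean over the circle of a function with values in the extended reals, as the difference of the
  integrals of the positive and the negative part. The positive part has a finite integral if
  the function is upper semicontinuous and nowhere \<open>\<infinity>\<close>; the value \<open>-\<infinity>\<close> is possible.
\<close>

definition circle_mean :: "(real \<Rightarrow> ereal) \<Rightarrow> ereal" where
  "circle_mean f = ereal (1 / (2 * pi)) *
     (enn2ereal (\<integral>\<^sup>+\<theta>\<in>{0..2*pi}. e2ennreal (f \<theta>) \<partial>lborel)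
      - enn2ereal (\<integral>\<^sup>+\<theta>\<in>{0..2*pi}. e2ennreal (- f \<theta>) \<partial>lborel))"

lemma circle_mean_continuous:
  fixes f :: "real \<Rightarrow> real"
  assumes "continuous_on {0..2*pi} f"
  shows "circle_mean (\<lambda>\<theta>. ereal (f \<theta>)) = ereal (1 / (2 * pi) * integral {0..2*pi} f)"
proof -
  define I where "I g = integral {0..2*pi} g" for g :: "real \<Rightarrow> real"
  have nn: "(\<integral>\<^sup>+\<theta>\<in>{0..2*pi}. e2ennreal (ereal (g \<theta>)) \<partial>lborel) = ennreal (I (\<lambda>\<theta>. max 0 (g \<theta>)))"
    and nonneg: "I (\<lambda>\<theta>. max 0 (g \<theta>)) \<ge> 0"
    if g: "continuous_on {0..2*pi} g" for g
  proof -
    have c: "continuous_on {0..2*pi} (\<lambda>\<theta>. max 0 (g \<theta>))"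
      by (intro continuous_intros g)
    have eq: "ennreal (g \<theta>) = ennreal (max 0 (g \<theta>))" for \<theta>
      by (cases "0 \<le> g \<theta>") (simp_all add: max_def ennreal_neg)
    have sib: "set_integrable lborel {0..2*pi} (\<lambda>\<theta>. max 0 (g \<theta>))"
      by (rule borel_integrable_compact[unfolded set_integrable_def[symmetric]]) (use c in auto)
    have "(\<integral>\<^sup>+\<theta>\<in>{0..2*pi}. e2ennreal (ereal (g \<theta>)) \<partial>lborel)
        = (\<integral>\<^sup>+\<theta>. ennreal (indicator {0..2*pi} \<theta> *\<^sub>R max 0 (g \<theta>)) \<partial>lborel)"
      by (intro nn_integral_cong) (simp add: eq indicator_def)
    also have "\<dots> = ennreal (LBINT \<theta>:{0..2*pi}. max 0 (g \<theta>))"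
      unfolding set_lebesgue_integral_def
      by (rule nn_integral_eq_integral) (use sib in \<open>auto simp: set_integrable_def\<close>)
    also have "(LBINT \<theta>:{0..2*pi}. max 0 (g \<theta>)) = I (\<lambda>\<theta>. max 0 (g \<theta>))"
      unfolding I_def using set_borel_integral_eq_integral(2)[OF sib] .
    finally show "(\<integral>\<^sup>+\<theta>\<in>{0..2*pi}. e2ennreal (ereal (g \<theta>)) \<partial>lborel) = ennreal (I (\<lambda>\<theta>. max 0 (g \<theta>)))" .
    show "I (\<lambda>\<theta>. max 0 (g \<theta>)) \<ge> 0"
      unfolding I_def by (rule integral_nonneg) (use c in \<open>auto intro: integrable_continuous_real\<close>)
  qed
  have m: "continuous_on {0..2*pi} (\<lambda>\<theta>. - f \<theta>)"
    using assms by (intro continuous_intros)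
  have "I (\<lambda>\<theta>. max 0 (f \<theta>)) - I (\<lambda>\<theta>. max 0 (- f \<theta>)) = I (\<lambda>\<theta>. max 0 (f \<theta>) - max 0 (- f \<theta>))"
    unfolding I_def
    by (rule integral_diff[symmetric]; rule integrable_continuous_real; intro continuous_intros assms m)
  also have "(\<lambda>\<theta>. max 0 (f \<theta>) - max 0 (- f \<theta>)) = f"
    by (auto simp: max_def)
  finally show ?thesis
    using nn[OF assms] nn[OF m] nonneg[OF assms] nonneg[OF m]
    by (simp add: circle_mean_def I_def)
qed

context complex_normed_space
begin

definition upper_semicontinuous_on :: "'a set \<Rightarrow> ('a \<Rightarrow> ereal) \<Rightarrow> bool" where
  "upper_semicontinuous_on V g \<longleftrightarrow>
     (\<forall>c. openin (subtopology metric.mtopology V) {x \<in> V. g x < c})"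

definition lower_semicontinuous_on :: "'a set \<Rightarrow> ('a \<Rightarrow> real) \<Rightarrow> bool" where
  "lower_semicontinuous_on V g \<longleftrightarrow>
     (\<forall>c. openin (subtopology metric.mtopology V) {x \<in> V. c < g x})"

definition uniformly_psh_on_average :: "'a set \<Rightarrow> ('a \<Rightarrow> ereal) \<Rightarrow> bool" where
  "uniformly_psh_on_average V g \<longleftrightarrow>
     openin metric.mtopology V \<and> (\<forall>z\<in>V. g z < \<infinity>) \<and> upper_semicontinuous_on V g \<and>
     (\<exists>L>0. \<exists>\<delta> :: 'a \<Rightarrow> real. (\<forall>a\<in>V. 0 < \<delta> a) \<and> lower_semicontinuous_on V \<delta> \<and>
        (\<forall>a\<in>V. \<forall>b\<in>X. nrm b < \<delta> a \<longrightarrow>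
           (\<forall>\<zeta>. cmod \<zeta> \<le> 1 \<longrightarrow> a + \<zeta> \<cdot> b \<in> V) \<and>
           ereal (L * (nrm b)\<^sup>2) + g a \<le> circle_mean (\<lambda>\<theta>. g (a + cis \<theta> \<cdot> b))))"

definition bounded_domain :: "'a set \<Rightarrow> bool" where
  "bounded_domain U \<longleftrightarrow>
     U \<noteq> {} \<and> openin metric.mtopology U \<and> connectedin metric.mtopology U \<and> metric.mbounded U"

end

locale complex_banach_space = complex_normed_space scale X nrm
  for scale :: "complex \<Rightarrow> 'a::ab_group_add \<Rightarrow> 'a" and X :: "'a set" and nrm :: "'a \<Rightarrow> real" +
  assumes complete: "metric.mcomplete"
begin

definition uniformly_pseudoconvex :: "nat \<Rightarrow> 'a set \<Rightarrow> bool" where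
  "uniformly_pseudoconvex l U \<longleftrightarrow>
     1 \<le> l \<and> bounded_domain U \<and>
     (\<exists>V r. defining_function l U V r \<and> uniformly_psh_on_average V (\<lambda>z. ereal (r z)))"

end

section \<open>The spaces \<open>\<ell>\<^sub>p\<close>\<close>

definition seq_scale :: "complex \<Rightarrow> (nat \<Rightarrow> complex) \<Rightarrow> nat \<Rightarrow> complex" where
  "seq_scale c x = (\<lambda>n. c * x n)"

definition lp_space :: "real \<Rightarrow> (nat \<Rightarrow> complex) set" where
  "lp_space p = {x. summable (\<lambda>n. cmod (x n) powr p)}"

definition lp_norm :: "real \<Rightarrow> (nat \<Rightarrow> complex) \<Rightarrow> real" where
  "lp_norm p x = (\<Sum>n. cmod (x n) powr p) powr (1 / p)"

lemma powr_convex_combination: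
  fixes s t u v p :: real
  assumes "1 \<le> p" "0 \<le> u" "0 \<le> v" "0 \<le> s" "0 \<le> t" "s + t = 1"
  shows "(s * u + t * v) powr p \<le> s * u powr p + t * v powr p"
proof -
  have le: "c powr p \<le> c" if "0 \<le> c" "c \<le> 1" for c :: real
    using that powr_mono'[of 1 p c] assms(1) by simp
  consider "u = 0" | "v = 0" | "0 < u" "0 < v" using assms by linarith
  then show ?thesis
  proof cases
    case 1
    then show ?thesis using le[of t] assms by (auto simp: powr_mult intro!: mult_right_mono)
  next
    case 2
    then show ?thesis using le[of s] assms by (auto simp: powr_mult intro!: mult_right_mono)
  next
    case 3
    moreover have "s = 1 - t" using assms by simp
    ultimately show ?thesis
      using convex_onD[OF powr_convex[OF assms(1)], of t u v] assms(5) \<open>0 \<le> s\<close> by simp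
  qed
qed

lemma lp_norm_nonneg: "0 \<le> lp_norm p x"
  by (simp add: lp_norm_def)

lemma lp_norm_powr:
  assumes "1 \<le> p" "x \<in> lp_space p"
  shows "lp_norm p x powr p = (\<Sum>n. cmod (x n) powr p)"
  using assms suminf_nonneg[of "\<lambda>n. cmod (x n) powr p"]
  by (simp add: lp_norm_def lp_space_def powr_powr)

lemma lp_space_bounded:
  assumes "1 \<le> p" and C: "0 \<le> C" and bd: "\<And>N. (\<Sum>n<N. cmod (x n) powr p) \<le> C powr p"
  shows "x \<in> lp_space p" "lp_norm p x \<le> C"
proof -
  have s: "summable (\<lambda>n. cmod (x n) powr p)"
    by (rule summableI_nonneg_bounded[where x = "C powr p"]) (use bd in auto)
  then show "x \<in> lp_space p" by (simp add: lp_space_def)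
  have "(\<Sum>n. cmod (x n) powr p) \<le> C powr p"
    by (rule suminf_le_const[OF s bd])
  then have "lp_norm p x \<le> (C powr p) powr (1 / p)"
    unfolding lp_norm_def using assms(1) by (intro powr_mono2) (auto intro: suminf_nonneg s)
  then show "lp_norm p x \<le> C" using assms by (simp add: powr_powr)
qed

lemma lp_sum_le:
  assumes "1 \<le> p" "x \<in> lp_space p"
  shows "(\<Sum>n<N. cmod (x n) powr p) \<le> lp_norm p x powr p"
  unfolding lp_norm_powr[OF assms]
  by (rule sum_le_suminf) (use assms in \<open>auto simp: lp_space_def\<close>)

lemma lp_coordinate_le:
  assumes "1 \<le> p" "x \<in> lp_space p"
  shows "cmod (x n) \<le> lp_norm p x"
proof -
  have "cmod (x n) powr p \<le> (\<Sum>k<Suc n. cmod (x k) powr p)"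
    by (simp add: sum_nonneg)
  also have "\<dots> \<le> lp_norm p x powr p" by (rule lp_sum_le[OF assms])
  finally show ?thesis
    using assms(1) lp_norm_nonneg[of p x] by (smt (verit) norm_ge_zero powr_less_mono2)
qed

lemma lp_zero: "0 \<in> lp_space p" "lp_norm p 0 = 0"
  by (simp_all add: lp_space_def lp_norm_def)

lemma lp_norm_eq_0:
  assumes "1 \<le> p" "x \<in> lp_space p"
  shows "lp_norm p x = 0 \<longleftrightarrow> x = 0"
proof
  assume "lp_norm p x = 0"
  then show "x = 0" using lp_coordinate_le[OF assms] by (auto simp: fun_eq_iff)
qed (simp add: lp_zero)

lemma lp_scale:
  assumes "1 \<le> p" "x \<in> lp_space p"
  shows "seq_scale c x \<in> lp_space p" "lp_norm p (seq_scale c x) = cmod c * lp_norm p x"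
proof -
  have s: "summable (\<lambda>n. cmod (x n) powr p)" using assms by (simp add: lp_space_def)
  show "seq_scale c x \<in> lp_space p"
    using summable_mult[OF s, of "cmod c powr p"]
    by (simp add: lp_space_def seq_scale_def norm_mult powr_mult)
  have "(\<Sum>n. cmod (c * x n) powr p) = cmod c powr p * (\<Sum>n. cmod (x n) powr p)"
    using suminf_mult[OF s, of "cmod c powr p"] by (simp add: norm_mult powr_mult)
  then show "lp_norm p (seq_scale c x) = cmod c * lp_norm p x"
    using assms(1) suminf_nonneg[OF s] by (simp add: lp_norm_def seq_scale_def powr_mult powr_powr)
qed

lemma lp_add:
  assumes p: "1 \<le> p" and x: "x \<in> lp_space p" and y: "y \<in> lp_space p"
  shows "x + y \<in> lp_space p" "lp_norm p (x + y) \<le> lp_norm p x + lp_norm p y"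
proof -
  define a b where "a = lp_norm p x" and "b = lp_norm p y"
  have "x + y \<in> lp_space p \<and> lp_norm p (x + y) \<le> a + b"
  proof (cases "a = 0 \<or> b = 0")
    case True
    then show ?thesis
      using lp_norm_eq_0[OF p x] lp_norm_eq_0[OF p y] x y by (auto simp: a_def b_def lp_norm_nonneg)
  next
    case False
    then have ab: "0 < a" "0 < b" using lp_norm_nonneg by (auto simp: a_def b_def less_le)
    define s t where "s = a / (a + b)" and "t = b / (a + b)"
    have st: "0 \<le> s" "0 \<le> t" "s + t = 1"
      using ab by (auto simp: s_def t_def add_divide_distrib[symmetric])
    have pt: "cmod ((x + y) n) powr p \<le>
        (a + b) powr p * (s * (cmod (x n) / a) powr p + t * (cmod (y n) / b) powr p)" for n
    proof -
      have "cmod ((x + y) n) \<le> (a + b) * (s * (cmod (x n) / a) + t * (cmod (y n) / b))"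
      proof -
        have "(a + b) * s = a" "(a + b) * t = b"
          using ab by (simp_all add: s_def t_def)
        then have "(a + b) * (s * (cmod (x n) / a) + t * (cmod (y n) / b)) = cmod (x n) + cmod (y n)"
          using ab by (simp add: distrib_left mult.assoc[symmetric])
        then show ?thesis using norm_triangle_ineq[of "x n" "y n"] by simp
      qed
      then have "cmod ((x + y) n) powr p \<le> ((a + b) * (s * (cmod (x n) / a) + t * (cmod (y n) / b))) powr p"
        using p by (intro powr_mono2) auto
      also have "\<dots> = (a + b) powr p * (s * (cmod (x n) / a) + t * (cmod (y n) / b)) powr p"
        by (rule powr_mult)
      also have "\<dots> \<le> (a + b) powr p * (s * (cmod (x n) / a) powr p + t * (cmod (y n) / b) powr p)"
        using ab st p by (intro mult_left_mono powr_convex_combination) auto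
      finally show ?thesis .
    qed
    have "(\<Sum>n<N. cmod ((x + y) n) powr p) \<le> (a + b) powr p" for N
    proof -
      have one: "(\<Sum>n<N. (cmod (z n) / c) powr p) \<le> 1"
        if "c = lp_norm p z" "0 < c" "z \<in> lp_space p" for z c
        using lp_sum_le[OF p that(3), of N] that
        by (simp add: powr_divide sum_divide_distrib[symmetric])
      have "(\<Sum>n<N. cmod ((x + y) n) powr p) \<le>
          (\<Sum>n<N. (a + b) powr p * (s * (cmod (x n) / a) powr p + t * (cmod (y n) / b) powr p))"
        by (intro sum_mono pt)
      also have "\<dots> = (a + b) powr p *
          (s * (\<Sum>n<N. (cmod (x n) / a) powr p) + t * (\<Sum>n<N. (cmod (y n) / b) powr p))"
        by (simp add: sum_distrib_left[symmetric] sum.distrib)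
      also have "\<dots> \<le> (a + b) powr p * (s * 1 + t * 1)"
        using st ab x y one[of a x] one[of b y]
        by (intro mult_left_mono add_mono) (auto simp: a_def b_def)
      finally show ?thesis using st by simp
    qed
    then show ?thesis
      using lp_space_bounded[OF p, of "a + b" "x + y"] ab by auto
  qed
  then show "x + y \<in> lp_space p" "lp_norm p (x + y) \<le> lp_norm p x + lp_norm p y"
    by (simp_all add: a_def b_def)
qed

lemma lp_complex_normed_space:
  assumes "1 \<le> p"
  shows "complex_normed_space seq_scale (lp_space p) (lp_norm p)"
proof -
  interpret vector_space seq_scale
    by unfold_locales (auto simp: seq_scale_def fun_eq_iff algebra_simps)
  show ?thesis
    by unfold_locales
      (auto simp: assms subspace_def lp_zero lp_add lp_scale lp_norm_eq_0 lp_norm_nonneg)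
qed

theorem lp_complex_banach_space:
  assumes p: "1 \<le> p"
  shows "complex_banach_space seq_scale (lp_space p) (lp_norm p)"
proof -
  interpret complex_normed_space seq_scale "lp_space p" "lp_norm p"
    by (rule lp_complex_normed_space[OF p])
  have diff: "x - y \<in> lp_space p" if "x \<in> lp_space p" "y \<in> lp_space p" for x y
    using that subspace_carrier by (rule_tac subspace_diff)
  have "metric.mcomplete"
    unfolding metric.mcomplete_def
  proof (intro allI impI)
    fix \<sigma> assume C: "metric.MCauchy \<sigma>"
    then have in_lp: "\<sigma> n \<in> lp_space p" for n
      by (auto simp: metric.MCauchy_def)
    have cau: "\<exists>N. \<forall>m n. N \<le> m \<longrightarrow> N \<le> n \<longrightarrow> lp_norm p (\<sigma> m - \<sigma> n) < e" if "0 < e" for e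
      using C that in_lp by (simp add: metric.MCauchy_def ndist_def)
    have "convergent (\<lambda>m. \<sigma> m k)" for k
    proof -
      have "\<exists>N. \<forall>m\<ge>N. \<forall>n\<ge>N. cmod (\<sigma> m k - \<sigma> n k) < e" if "0 < e" for e
      proof -
        obtain N where N: "\<And>m n. N \<le> m \<Longrightarrow> N \<le> n \<Longrightarrow> lp_norm p (\<sigma> m - \<sigma> n) < e"
          using cau[OF \<open>0 < e\<close>] by blast
        have "cmod (\<sigma> m k - \<sigma> n k) < e" if "N \<le> m" "N \<le> n" for m n
          using lp_coordinate_le[OF p diff[OF in_lp in_lp], of m n k] N[OF that] by simp
        then show ?thesis by blast
      qed
      then show ?thesis by (intro Cauchy_convergent CauchyI)
    qed
    then obtain x where x: "\<And>k. (\<lambda>m. \<sigma> m k) \<longlonglongrightarrow> x k"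
      unfolding convergent_def by metis
    have near: "\<exists>N. \<forall>m\<ge>N. \<sigma> m - x \<in> lp_space p \<and> lp_norm p (\<sigma> m - x) \<le> e" if e: "0 < e" for e
    proof -
      obtain N where N: "\<And>m n. N \<le> m \<Longrightarrow> N \<le> n \<Longrightarrow> lp_norm p (\<sigma> m - \<sigma> n) < e"
        using cau[of e] e by blast
      have "(\<Sum>k<K. cmod ((\<sigma> m - x) k) powr p) \<le> e powr p" if m: "N \<le> m" for m K
      proof (rule LIMSEQ_le_const2)
        show "(\<lambda>n. \<Sum>k<K. cmod ((\<sigma> m - \<sigma> n) k) powr p) \<longlonglongrightarrow> (\<Sum>k<K. cmod ((\<sigma> m - x) k) powr p)"
          using p by (auto intro!: tendsto_intros x)
        have "(\<Sum>k<K. cmod ((\<sigma> m - \<sigma> n) k) powr p) \<le> e powr p" if "N \<le> n" for n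
        proof -
          have "(\<Sum>k<K. cmod ((\<sigma> m - \<sigma> n) k) powr p) \<le> lp_norm p (\<sigma> m - \<sigma> n) powr p"
            by (rule lp_sum_le[OF p diff[OF in_lp in_lp]])
          also have "\<dots> \<le> e powr p"
            using N[OF m that] p by (intro powr_mono2) (auto simp: lp_norm_nonneg)
          finally show ?thesis .
        qed
        then show "\<exists>N. \<forall>n\<ge>N. (\<Sum>k<K. cmod ((\<sigma> m - \<sigma> n) k) powr p) \<le> e powr p" by blast
      qed
      then show ?thesis using lp_space_bounded[OF p, of e] e by (meson less_imp_le)
    qed
    obtain M where "\<sigma> M - x \<in> lp_space p" using near[of 1] by auto
    then have x_lp: "x \<in> lp_space p"
      using diff[OF in_lp[of M]] by fastforce
    have "\<exists>N. \<forall>m\<ge>N. lp_norm p (\<sigma> m - x) < e" if "0 < e" for e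
      using near[of "e / 2"] that by fastforce
    then show "\<exists>x. limitin metric.mtopology \<sigma> x sequentially"
      using x_lp in_lp by (auto simp: metric.limit_metric_sequentially ndist_def)
  qed
  then show ?thesis by unfold_locales
qed

end

theory Submission
  imports Defs
begin

text \<open>
  The defining function is \<open>r(z) = \<parallel>z\<parallel>\<^sup>p - 1 = (\<Sum>n. \<bar>z\<^sub>n\<bar>\<^sup>p) - 1\<close>, on the open ball of radius \<open>2\<close>.

  Smoothness. For \<open>1 < p \<le> 2\<close> the function \<open>\<bar>z\<bar>\<^sup>p\<close> has a gradient that is Hoelder continuous with
  exponent \<open>p - 1\<close> (\<open>powr_gradient_holder\<close>). Together with convexity this bounds the first
  order Taylor remainder by a multiple of \<open>\<bar>w - z\<bar>\<^sup>p\<close> (\<open>norm_powr_taylor\<close>). Both bounds have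
  the right homogeneity to be summed over the coordinates, with Hoelder's inequality, so \<open>r\<close> is
  even of class \<open>C\<^sup>1\<^sup>,\<^sup>p\<^sup>-\<^sup>1\<close>. Its derivative at \<open>w\<close> sends \<open>w\<close> to \<open>p \<parallel>w\<parallel>\<^sup>p\<close>, which does not vanish on the
  unit sphere.

  Uniform plurisubharmonicity. In fact \<open>r\<close> is uniformly convex on bounded sets, with a quadratic
  modulus: if \<open>\<parallel>a\<parallel> + \<parallel>u\<parallel> \<le> W\<close> then
  \<open>(\<parallel>a + u\<parallel>\<^sup>p + \<parallel>a - u\<parallel>\<^sup>p) / 2 \<ge> \<parallel>a\<parallel>\<^sup>p + p (p - 1) / 2 * W\<^sup>p\<^sup>-\<^sup>2 \<parallel>u\<parallel>\<^sup>2\<close>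
  (\<open>lp_norm_powr_midpoint_gap\<close>). With \<open>u = e\<^sup>i\<^sup>\<theta> b\<close>, averaging this over a half circle gives the average
  over the full circle, because \<open>\<theta>\<close> and \<open>\<theta> + \<pi>\<close> are the two signs of \<open>u\<close>. The choice
  \<open>\<delta>(a) = 2 - \<parallel>a\<parallel>\<close> keeps the disks inside the ball of radius \<open>2\<close> and permits \<open>W = 2\<close>.

  The midpoint inequality is proved first for a single coordinate (\<open>norm_powr_midpoint_gap\<close>), where
  it rests on the lower bound \<open>p (p - 1) W\<^sup>p\<^sup>-\<^sup>2\<close> for the second derivative of \<open>x \<mapsto> x\<^sup>p\<close> on \<open>(0, W]\<close>.
  There \<open>W\<close> can be taken as the size \<open>w\<^sub>n = \<bar>a\<^sub>n\<bar> + \<bar>u\<^sub>n\<bar>\<close> of the coordinate. The resulting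
  weighted squares \<open>w\<^sub>n\<^sup>p\<^sup>-\<^sup>2 \<bar>u\<^sub>n\<bar>\<^sup>2\<close> are summed with the reverse Hoelder inequality
  \<open>\<Sum>n. w\<^sub>n\<^sup>p\<^sup>-\<^sup>2 \<bar>u\<^sub>n\<bar>\<^sup>2 \<ge> W\<^sup>p\<^sup>-\<^sup>2 \<parallel>u\<parallel>\<^sup>2\<close>, in the linearised form \<open>powr_le_weighted_square\<close>.
\<close>

section \<open>Powers of real numbers\<close>

text \<open>
  Young's inequality without fractions. It is the source of Hoelder's inequality in \<open>\<ell>\<^sub>p\<close> and of the
  convexity of \<open>\<bar>z\<bar>\<^sup>p\<close>.
\<close>

lemma young_powr:
  fixes p s t :: real
  assumes "1 < p" "0 \<le> s" "0 \<le> t"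
  shows "p * s powr (p - 1) * t \<le> t powr p + (p - 1) * s powr p"
proof -
  have "t * s powr (p - 1) \<le> t powr p / p + (s powr (p - 1)) powr (p / (p - 1)) / (p / (p - 1))"
    using assms by (intro Youngs_inequality) (auto simp: field_simps)
  also have "(s powr (p - 1)) powr (p / (p - 1)) = s powr p"
    using assms by (simp add: powr_powr)
  finally have "p * (t * s powr (p - 1)) \<le> p * (t powr p / p + s powr p / (p / (p - 1)))"
    using assms by (intro mult_left_mono) auto
  also have "\<dots> = t powr p + (p - 1) * s powr p"
    using assms by (simp add: distrib_left)
  finally show ?thesis
    by (simp add: mult_ac)
qed

text \<open>
  The concave function \<open>x \<mapsto> x\<^sup>p\<^sup>/\<^sup>2\<close> lies below its tangent at \<open>1\<close>; here \<open>x = t\<^sup>2\<close>.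
\<close>

lemma powr_le_affine_square:
  fixes p t :: real
  assumes "0 < p" "p \<le> 2" "0 \<le> t"
  shows "t powr p \<le> p / 2 * t\<^sup>2 + (1 - p / 2)"
proof (cases "t = 0")
  case False
  then have "(t\<^sup>2) powr (p / 2) * 1 powr (1 - p / 2) \<le> p / 2 * t\<^sup>2 + (1 - p / 2) * 1"
    using assms by (intro Youngs_inequality_0) auto
  moreover have "(t\<^sup>2) powr (p / 2) = t powr p"
    using assms False powr_powr[of t 2 "p / 2"] by (simp add: powr_numeral)
  ultimately show ?thesis by simp
qed (use assms in auto)

text \<open>
  Subadditivity of concave powers. After division by \<open>x\<close> the two summands lie in \<open>[0, 1]\<close>, where
  \<open>c \<le> c\<^sup>\<alpha>\<close>.
\<close>

lemma powr_diff_le: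
  fixes \<alpha> x y :: real
  assumes "0 < \<alpha>" "\<alpha> \<le> 1" "0 \<le> y" "y \<le> x"
  shows "x powr \<alpha> - y powr \<alpha> \<le> (x - y) powr \<alpha>"
proof (cases "x = 0")
  case False
  have le: "c \<le> c powr \<alpha>" if "0 \<le> c" "c \<le> 1" for c :: real
    using that powr_mono'[of \<alpha> 1 c] assms by simp
  have "1 = (x - y) / x + y / x"
    using False by (simp add: field_simps)
  also have "\<dots> \<le> ((x - y) / x) powr \<alpha> + (y / x) powr \<alpha>"
    using assms False by (intro add_mono le) (auto simp: field_simps)
  also have "\<dots> = ((x - y) powr \<alpha> + y powr \<alpha>) / x powr \<alpha>"
    using assms by (simp add: powr_divide add_divide_distrib)
  finally show ?thesis
    using False assms by (simp add: field_simps)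
qed (use assms in auto)

text \<open>
  For \<open>p < 2\<close> and \<open>w\<^sub>n \<ge> \<bar>u\<^sub>n\<bar>\<close>, Hoelder's inequality with the exponents \<open>2 / p\<close> and \<open>2 / (2 - p)\<close> bounds
  \<open>\<Sum>n. \<bar>u\<^sub>n\<bar>\<^sup>p\<close> by a product of powers of \<open>\<Sum>n. w\<^sub>n\<^sup>p\<^sup>-\<^sup>2 \<bar>u\<^sub>n\<bar>\<^sup>2\<close> and \<open>\<Sum>n. w\<^sub>n\<^sup>p\<close>. This is the termwise
  inequality behind it. It is linear in the three summands, so that it can be summed at once; the
  optimisation is postponed to the choice of the scale \<open>\<rho>\<close>.
\<close>

lemma powr_le_weighted_square:
  fixes p \<rho> w x :: real
  assumes p: "1 < p" "p \<le> 2" and \<rho>: "0 < \<rho>" and x: "0 \<le> x" "x \<le> w"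
  shows "\<rho> powr (2 - p) * (2 / p) * (x powr p - (1 - p / 2) * \<rho> powr p * w powr p) \<le> w powr (p - 2) * x\<^sup>2"
proof (cases "w = 0")
  case False
  then have w: "0 < w" using x by simp
  \<comment> \<open>By homogeneity this is the affine bound for powers at the quotient t.\<close>
  define t where "t = x / (\<rho> * w)"
  have xt: "x = t * (\<rho> * w)" and t: "0 \<le> t"
    using w \<rho> x by (auto simp: t_def)
  have split: "c powr p = c powr (p - 2) * c\<^sup>2" if "0 < c" for c :: real
    using that powr_add[of c "p - 2" 2] by (simp add: powr_numeral)
  have "t powr p - (1 - p / 2) \<le> p / 2 * t\<^sup>2"
    using powr_le_affine_square[of p t] p t by simp
  then have "(\<rho> * w) powr p * (t powr p - (1 - p / 2)) \<le> (\<rho> * w) powr p * (p / 2 * t\<^sup>2)"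
    by (intro mult_left_mono) auto
  also have "(\<rho> * w) powr p * (t powr p - (1 - p / 2)) = x powr p - (1 - p / 2) * \<rho> powr p * w powr p"
    using \<rho> w t by (simp add: xt powr_mult algebra_simps)
  also have "(\<rho> * w) powr p * (p / 2 * t\<^sup>2) = p / 2 * (\<rho> powr (p - 2) * (w powr (p - 2) * x\<^sup>2))"
    using \<rho> w t by (simp add: xt powr_mult split[of \<rho>] split[of w] power_mult_distrib)
  finally have "\<rho> powr (2 - p) * (2 / p) * (x powr p - (1 - p / 2) * \<rho> powr p * w powr p)
      \<le> \<rho> powr (2 - p) * (2 / p) * (p / 2 * (\<rho> powr (p - 2) * (w powr (p - 2) * x\<^sup>2)))"
    using p by (intro mult_left_mono) auto
  also have "\<dots> = (\<rho> powr (2 - p) * \<rho> powr (p - 2)) * (w powr (p - 2) * x\<^sup>2)"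
    using p by simp
  also have "\<rho> powr (2 - p) * \<rho> powr (p - 2) = 1"
    using \<rho> by (simp flip: powr_add)
  finally show ?thesis by simp
qed (use x in auto)

section \<open>The gradient of the \<open>p\<close>-th power of a norm\<close>

text \<open>
  This is \<open>p \<bar>z\<bar>\<^sup>p\<^sup>-\<^sup>2 z\<close>. The factor \<open>sgn z\<close> makes it vanish at \<open>z = 0\<close>, where the gradient of \<open>\<bar>z\<bar>\<^sup>p\<close> is \<open>0\<close>
  because \<open>p > 1\<close>.
\<close>

definition powr_gradient :: "real \<Rightarrow> 'a::real_inner \<Rightarrow> 'a" where
  "powr_gradient p z = (p * norm z powr (p - 1)) *\<^sub>R sgn z"

lemma norm_powr_gradient:
  assumes "1 < p"
  shows "norm (powr_gradient p z) = p * norm z powr (p - 1)"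
  using assms by (simp add: powr_gradient_def norm_sgn)

lemma powr_gradient_inner_self:
  assumes "1 < p"
  shows "powr_gradient p z \<bullet> z = p * norm z powr p"
proof (cases "z = 0")
  case False
  have "sgn z \<bullet> z = norm z"
    using False by (simp add: sgn_div_norm dot_square_norm power2_eq_square)
  then show ?thesis
    using False powr_mult_base[of "norm z" "p - 1"]
    by (simp add: powr_gradient_def mult.assoc mult.commute)
qed (use assms in \<open>auto simp: powr_gradient_def\<close>)

text \<open>
  For \<open>\<bar>w\<bar> \<le> \<bar>z\<bar>\<close> the difference splits into a radial part, controlled by the subadditivity of
  \<open>x \<mapsto> x\<^sup>p\<^sup>-\<^sup>1\<close>, and an angular part \<open>\<bar>w\<bar>\<^sup>p\<^sup>-\<^sup>1 (sgn z - sgn w)\<close>, which contribute \<open>1\<close> and \<open>2\<close> to the constant. If \<open>\<bar>w\<bar>\<close> is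
  at most \<open>d = \<bar>z - w\<bar>\<close>, the angular part is at most \<open>2 d\<^sup>p\<^sup>-\<^sup>1\<close> trivially. Otherwise
  \<open>\<bar>w\<bar> \<bar>sgn z - sgn w\<bar> \<le> 2 d\<close> is multiplied by \<open>\<bar>w\<bar>\<^sup>p\<^sup>-\<^sup>2 \<le> d\<^sup>p\<^sup>-\<^sup>2\<close>.
\<close>

lemma powr_gradient_holder:
  fixes z w :: "'a::real_inner"
  assumes p: "1 < p" "p \<le> 2"
  shows "norm (powr_gradient p z - powr_gradient p w) \<le> 3 * p * norm (z - w) powr (p - 1)"
proof -
  have ordered: "norm (powr_gradient p z - powr_gradient p w) \<le> 3 * p * norm (z - w) powr (p - 1)"
    if le: "norm w \<le> norm z" for z w :: 'a
  proof -
    define d where "d = norm (z - w)"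
    have rad: "norm z powr (p - 1) - norm w powr (p - 1) \<le> d powr (p - 1)"
    proof -
      have "norm z powr (p - 1) - norm w powr (p - 1) \<le> (norm z - norm w) powr (p - 1)"
        using p le by (intro powr_diff_le) auto
      also have "\<dots> \<le> d powr (p - 1)"
        using p le norm_triangle_ineq2[of z w] by (intro powr_mono2) (auto simp: d_def)
      finally show ?thesis .
    qed
    have sph: "norm w * norm (sgn z - sgn w) \<le> 2 * d"
    proof -
      have polar: "norm x *\<^sub>R sgn x = x" for x :: 'a
        by (cases "x = 0") (simp_all add: sgn_div_norm)
      have "norm w *\<^sub>R (sgn z - sgn w) = (z - w) - (norm z - norm w) *\<^sub>R sgn z"
        by (simp add: scaleR_diff_right scaleR_diff_left polar)
      then have "norm w * norm (sgn z - sgn w) = norm ((z - w) - (norm z - norm w) *\<^sub>R sgn z)"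
        by (metis abs_norm_cancel norm_scaleR)
      also have "\<dots> \<le> norm (z - w) + norm ((norm z - norm w) *\<^sub>R sgn z)"
        by (rule norm_triangle_ineq4)
      also have "norm ((norm z - norm w) *\<^sub>R sgn z) \<le> norm (z - w)"
        using norm_triangle_ineq3[of z w] by (simp add: norm_sgn)
      finally show ?thesis by (simp add: d_def)
    qed
    have ang: "norm w powr (p - 1) * norm (sgn z - sgn w) \<le> 2 * d powr (p - 1)"
    proof (cases "norm w \<le> d")
      case True
      have "norm (sgn z - sgn w) \<le> norm (sgn z) + norm (sgn w)"
        by (rule norm_triangle_ineq4)
      then have "norm (sgn z - sgn w) \<le> 2"
        by (auto simp: norm_sgn split: if_splits)
      moreover have "norm w powr (p - 1) \<le> d powr (p - 1)"
        using True p by (intro powr_mono2) auto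
      ultimately have "norm w powr (p - 1) * norm (sgn z - sgn w) \<le> d powr (p - 1) * 2"
        by (intro mult_mono) auto
      then show ?thesis by simp
    next
      case False
      show ?thesis
      proof (cases "d = 0")
        case True
        then show ?thesis by (simp add: d_def)
      next
        case d0: False
        then have d: "0 < d" by (simp add: d_def)
        have e: "c powr (p - 1) = c * c powr (p - 2)" if "0 < c" for c :: real
          using that powr_mult_base[of c "p - 2"] by (simp add: algebra_simps)
        have "norm w powr (p - 1) * norm (sgn z - sgn w)
            = norm w powr (p - 2) * (norm w * norm (sgn z - sgn w))"
          using False d by (subst e) auto
        also have "\<dots> \<le> d powr (p - 2) * (2 * d)"
          using False d p by (intro mult_mono[OF _ sph] powr_mono2') auto
        also have "\<dots> = 2 * d powr (p - 1)"
          by (simp add: e[OF d])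
        finally show ?thesis .
      qed
    qed
    have "powr_gradient p z - powr_gradient p w
        = p *\<^sub>R ((norm z powr (p - 1) - norm w powr (p - 1)) *\<^sub>R sgn z
             + norm w powr (p - 1) *\<^sub>R (sgn z - sgn w))"
      by (simp add: powr_gradient_def algebra_simps)
    then have "norm (powr_gradient p z - powr_gradient p w)
        = p * norm ((norm z powr (p - 1) - norm w powr (p - 1)) *\<^sub>R sgn z
             + norm w powr (p - 1) *\<^sub>R (sgn z - sgn w))"
      using p by simp
    also have "\<dots> \<le> p * (norm ((norm z powr (p - 1) - norm w powr (p - 1)) *\<^sub>R sgn z)
             + norm (norm w powr (p - 1) *\<^sub>R (sgn z - sgn w)))"
      using p by (intro mult_left_mono norm_triangle_ineq) auto
    also have "\<dots> \<le> p * (d powr (p - 1) + 2 * d powr (p - 1))"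
    proof (intro mult_left_mono add_mono)
      have "norm w powr (p - 1) \<le> norm z powr (p - 1)"
        using le p by (intro powr_mono2) auto
      then show "norm ((norm z powr (p - 1) - norm w powr (p - 1)) *\<^sub>R sgn z) \<le> d powr (p - 1)"
        using rad by (simp add: norm_sgn)
      show "norm (norm w powr (p - 1) *\<^sub>R (sgn z - sgn w)) \<le> 2 * d powr (p - 1)"
        using ang by simp
    qed (use p in auto)
    finally show ?thesis by (simp add: d_def)
  qed
  show ?thesis
  proof (cases "norm w \<le> norm z")
    case False
    then show ?thesis using ordered[of z w] by (simp add: norm_minus_commute)
  qed (rule ordered)
qed

text \<open>
  Convexity of \<open>\<bar>z\<bar>\<^sup>p\<close> is Young's inequality: by Cauchy-Schwarz only the norms of \<open>z\<close> and \<open>w\<close> matter.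
\<close>

lemma powr_gradient_subgradient:
  fixes z w :: "'a::real_inner"
  assumes p: "1 < p"
  shows "norm z powr p + powr_gradient p z \<bullet> (w - z) \<le> norm w powr p"
proof -
  have "powr_gradient p z \<bullet> w \<le> p * norm z powr (p - 1) * norm w"
    using norm_cauchy_schwarz[of "powr_gradient p z" w] by (simp add: norm_powr_gradient p)
  also have "\<dots> \<le> norm w powr p + (p - 1) * norm z powr p"
    using p by (intro young_powr) auto
  finally show ?thesis
    using p by (simp add: inner_diff_right powr_gradient_inner_self algebra_simps)
qed

text \<open>
  The remainder is nonnegative by the subgradient inequality at \<open>z\<close>; the one at \<open>w\<close> bounds it by the
  increment of the gradient paired with \<open>w - z\<close>.
\<close>

lemma norm_powr_taylor:
  fixes z w :: "'a::real_inner"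
  assumes p: "1 < p" "p \<le> 2"
  shows "\<bar>norm w powr p - norm z powr p - powr_gradient p z \<bullet> (w - z)\<bar> \<le> 3 * p * norm (w - z) powr p"
proof -
  have "norm w powr p - norm z powr p - powr_gradient p z \<bullet> (w - z)
      \<le> (powr_gradient p w - powr_gradient p z) \<bullet> (w - z)"
    using powr_gradient_subgradient[OF p(1), of w z] by (simp add: inner_diff_left inner_diff_right)
  also have "\<dots> \<le> norm (powr_gradient p w - powr_gradient p z) * norm (w - z)"
    by (rule norm_cauchy_schwarz)
  also have "\<dots> \<le> (3 * p * norm (w - z) powr (p - 1)) * norm (w - z)"
    by (intro mult_right_mono powr_gradient_holder p) auto
  also have "\<dots> = 3 * p * norm (w - z) powr p"
    using powr_mult_base[of "norm (w - z)" "p - 1"] by (simp add: mult_ac)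
  finally show ?thesis
    using powr_gradient_subgradient[OF p(1), of z w] by simp
qed

section \<open>Uniform convexity of the \<open>p\<close>-th power of a norm\<close>

text \<open>
  The constant \<open>k\<close> is half the minimum over \<open>(0, M]\<close> of the second derivative of \<open>x\<^sup>p\<close>, so \<open>x\<^sup>p - k x\<^sup>2\<close>
  is convex there and lies above its tangents. The point \<open>v = 0\<close>, where the second derivative may be
  infinite, is checked by hand.
\<close>

lemma powr_minus_square_tangent:
  fixes p M m v :: real
  assumes p: "1 < p" "p \<le> 2" and m: "0 < m" "m \<le> M" and v: "0 \<le> v" "v \<le> M"
  defines "k \<equiv> p * (p - 1) / 2 * M powr (p - 2)"
  shows "m powr p - k * m\<^sup>2 + (p * m powr (p - 1) - 2 * k * m) * (v - m) \<le> v powr p - k * v\<^sup>2"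
proof -
  have decr: "M powr (p - 2) \<le> x powr (p - 2)" if "0 < x" "x \<le> M" for x
    using that p by (intro powr_mono2') auto
  show ?thesis
  proof (cases "v = 0")
    case True
    have sq: "m powr (p - 2) * m\<^sup>2 = m powr p" and lin: "m powr (p - 1) * m = m powr p"
      using m powr_add[of m "p - 2" 2] powr_mult_base[of m "p - 1"]
      by (simp_all add: powr_numeral mult.commute)
    have "M powr (p - 2) * m\<^sup>2 \<le> m powr (p - 2) * m\<^sup>2"
      by (intro mult_right_mono decr m) auto
    then have "p * (p - 1) / 2 * (M powr (p - 2) * m\<^sup>2) \<le> p * (p - 1) / 2 * m powr p"
      unfolding sq using p by (intro mult_left_mono) auto
    then have "k * m\<^sup>2 \<le> p * (p - 1) / 2 * m powr p"
      by (simp add: k_def mult.assoc)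
    also have "\<dots> \<le> (p - 1) * m powr p"
      using p mult_right_mono[of "p / 2" 1 "p - 1"] by (intro mult_right_mono) simp_all
    finally have "k * m\<^sup>2 \<le> (p - 1) * m powr p" .
    moreover have "(p * m powr (p - 1) - 2 * k * m) * m = p * m powr p - 2 * (k * m\<^sup>2)"
      by (simp add: lin[symmetric] algebra_simps power2_eq_square)
    ultimately show ?thesis
      using True p by (simp add: algebra_simps)
  next
    case False
    have "(p * m powr (p - 1) - 2 * k * m) * (v - m) \<le> (v powr p - k * v\<^sup>2) - (m powr p - k * m\<^sup>2)"
    proof (rule f''_imp_f'[where C = "{0<..M}" and f'' = "\<lambda>x. p * (p - 1) * x powr (p - 2) - 2 * k"])
      fix x assume x: "x \<in> {0<..M}"
      show "((\<lambda>x. x powr p - k * x\<^sup>2) has_real_derivative p * x powr (p - 1) - 2 * k * x) (at x)"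
        using x by (auto intro!: derivative_eq_intros)
      show "((\<lambda>x. p * x powr (p - 1) - 2 * k * x) has_real_derivative
          p * (p - 1) * x powr (p - 2) - 2 * k) (at x)"
        using x by (auto intro!: derivative_eq_intros)
      have "p * (p - 1) * M powr (p - 2) \<le> p * (p - 1) * x powr (p - 2)"
        using x p decr by (intro mult_left_mono) auto
      then show "0 \<le> p * (p - 1) * x powr (p - 2) - 2 * k"
        by (simp add: k_def)
    qed (use m v False in auto)
    then show ?thesis by simp
  qed
qed

text \<open>
  With \<open>M = \<bar>a\<bar> + \<bar>u\<bar>\<close> and \<open>k\<close> as above, \<open>g(x) = x\<^sup>p - k x\<^sup>2\<close> is convex and nondecreasing on \<open>[0, M]\<close>; the
  latter uses \<open>p - 1 \<le> 1\<close>. Hence the average of \<open>g(\<bar>a + u\<bar>)\<close> and \<open>g(\<bar>a - u\<bar>)\<close> is at least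
  \<open>g((\<bar>a + u\<bar> + \<bar>a - u\<bar>) / 2) \<ge> g(\<bar>a\<bar>)\<close>. By the parallelogram law the quadratic terms contribute exactly
  \<open>k \<bar>u\<bar>\<^sup>2\<close>.
\<close>

lemma norm_powr_midpoint_gap:
  fixes a u :: "'a::real_inner"
  assumes p: "1 < p" "p \<le> 2"
  shows "norm a powr p + p * (p - 1) / 2 * (norm a + norm u) powr (p - 2) * (norm u)\<^sup>2
    \<le> (norm (a + u) powr p + norm (a - u) powr p) / 2"
proof -
  define M where "M = norm a + norm u"
  define k where "k = p * (p - 1) / 2 * M powr (p - 2)"
  show ?thesis
  proof (cases "a = 0")
    case True
    have "M powr (p - 2) * M\<^sup>2 = M powr p"
      using True powr_add[of M "p - 2" 2] by (cases "u = 0") (simp_all add: powr_numeral M_def)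
    then have "k * (norm u)\<^sup>2 = p * (p - 1) / 2 * norm u powr p"
      using True by (simp add: k_def M_def mult.assoc)
    also have "\<dots> \<le> 1 * norm u powr p"
    proof (rule mult_right_mono)
      have "p * (p - 1) \<le> 2 * 1" using p by (intro mult_mono) auto
      then show "p * (p - 1) / 2 \<le> 1" by simp
    qed simp
    finally show ?thesis
      using True p by (simp add: k_def M_def)
  next
    case False
    define s t m where "s = norm (a + u)" and "t = norm (a - u)" and "m = (s + t) / 2"
    have s: "0 \<le> s" "s \<le> M" and t: "0 \<le> t" "t \<le> M"
      using norm_triangle_ineq[of a u] norm_triangle_ineq4[of a u] by (auto simp: s_def t_def M_def)
    have "norm ((a + u) + (a - u)) \<le> s + t"
      unfolding s_def t_def by (rule norm_triangle_ineq)
    moreover have "(a + u) + (a - u) = 2 *\<^sub>R a"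
      by (simp add: scaleR_2)
    ultimately have am: "norm a \<le> m"
      by (simp add: m_def)
    have a: "0 < norm a" "norm a \<le> M"
      using False by (auto simp: M_def)
    have m: "0 < m" "m \<le> M"
      using am a(1) s t by (auto simp: m_def simp del: zero_less_norm_iff)
    note tangent = powr_minus_square_tangent[OF p, of _ M, folded k_def]
    have "2 * (m powr p - k * m\<^sup>2) \<le> (s powr p - k * s\<^sup>2) + (t powr p - k * t\<^sup>2)"
    proof -
      have "(s - m) + (t - m) = 0"
        by (simp add: m_def field_simps)
      then have "(p * m powr (p - 1) - 2 * k * m) * (s - m) + (p * m powr (p - 1) - 2 * k * m) * (t - m) = 0"
        by (simp flip: distrib_left)
      then show ?thesis
        using add_mono[OF tangent[OF m s] tangent[OF m t]] by (simp only: add.assoc add.left_commute mult_2)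
    qed
    \<comment> \<open>Monotonicity: the tangent at the norm of a has nonnegative slope.\<close>
    moreover have "norm a powr p - k * (norm a)\<^sup>2 \<le> m powr p - k * m\<^sup>2"
    proof -
      have "p * (p - 1) * M powr (p - 2) \<le> p * 1 * norm a powr (p - 2)"
        using a p by (intro mult_mono powr_mono2') auto
      then have "2 * k * norm a \<le> p * norm a powr (p - 2) * norm a"
        by (intro mult_right_mono) (auto simp: k_def)
      also have "\<dots> = p * norm a powr (p - 1)"
        using a powr_mult_base[of "norm a" "p - 2"] by (simp add: algebra_simps)
      finally have "0 \<le> (p * norm a powr (p - 1) - 2 * k * norm a) * (m - norm a)"
        using am by simp
      then show ?thesis
        using tangent[OF a, of m] m by simp
    qed
    moreover have "k * s\<^sup>2 + k * t\<^sup>2 = 2 * (k * (norm a)\<^sup>2) + 2 * (k * (norm u)\<^sup>2)"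
    proof -
      have "s\<^sup>2 + t\<^sup>2 = 2 * (norm a)\<^sup>2 + 2 * (norm u)\<^sup>2"
        by (simp add: s_def t_def power2_norm_eq_inner inner_add_left inner_add_right
            inner_diff_left inner_diff_right inner_commute)
      then show ?thesis
        by (metis (no_types, opaque_lifting) distrib_left mult.left_commute)
    qed
    moreover have "A + U' \<le> (S + T) / 2"
      if "2 * (M' - N') \<le> (S - S') + (T - T')" "A - A' \<le> M' - N'" "S' + T' = 2 * A' + 2 * U'"
      for A A' M' N' S S' T T' U' :: real
      using that by argo
    ultimately have "norm a powr p + k * (norm u)\<^sup>2 \<le> (s powr p + t powr p) / 2"
      by blast
    then show ?thesis by (simp add: k_def M_def s_def t_def)
  qed
qed

section \<open>Means over circles\<close>

text \<open>
  Pairing opposite points turns the integral over the circle into the integral over the upper half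
  circle of the symmetrised function.
\<close>

lemma circle_mean_ge_antipodal:
  fixes f :: "real \<Rightarrow> real"
  assumes cont: "continuous_on {0..2 * pi} f"
    and antipodal: "\<And>\<theta>. \<theta> \<in> {0..pi} \<Longrightarrow> c \<le> (f \<theta> + f (\<theta> + pi)) / 2"
  shows "ereal c \<le> circle_mean (\<lambda>\<theta>. ereal (f \<theta>))"
proof -
  have c1: "continuous_on {0..pi} f" and c2: "continuous_on {pi..2 * pi} f"
    by (auto intro!: continuous_on_subset[OF cont])
  have c3: "continuous_on {0..pi} (\<lambda>\<theta>. f (\<theta> + pi))"
    by (rule continuous_on_compose2[OF c2]) (auto intro!: continuous_intros)
  have "2 * pi * c = integral {0..pi} (\<lambda>\<theta>. 2 * c)"
    by simp
  also have "\<dots> \<le> integral {0..pi} (\<lambda>\<theta>. f \<theta> + f (\<theta> + pi))"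
    using antipodal c1 c3
    by (intro integral_le integrable_continuous_real continuous_intros) (auto simp: field_simps)
  also have "\<dots> = integral {0..pi} f + integral {0..pi} (\<lambda>\<theta>. f (\<theta> + pi))"
    by (intro integral_add integrable_continuous_real c1 c3)
  also have "integral {0..pi} (\<lambda>\<theta>. f (\<theta> + pi)) = integral {pi..2 * pi} f"
    using integral_shift_Icc_real[of 0 pi f pi] by (simp add: o_def add.commute)
  also have "integral {0..pi} f + integral {pi..2 * pi} f = integral {0..2 * pi} f"
    by (intro Henstock_Kurzweil_Integration.integral_combine integrable_continuous_real cont) auto
  finally have "c \<le> 1 / (2 * pi) * integral {0..2 * pi} f"
    by (simp add: field_simps)
  then show ?thesis
    by (simp add: circle_mean_continuous[OF cont])
qed

section \<open>Geometry and calculus in a complex normed space\<close>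

lemma openin_subtopology_preimage:
  assumes f: "continuous_map T euclideanreal f" and V: "V \<subseteq> topspace T" and "open S"
  shows "openin (subtopology T V) {x \<in> V. f x \<in> S}"
  using openin_continuous_map_preimage[OF continuous_map_from_subtopology[OF f, of V], of S] assms
  by (simp add: Int_absorb1)

context complex_normed_space
begin

lemma carrier_diff: "x \<in> X \<Longrightarrow> y \<in> X \<Longrightarrow> x - y \<in> X"
  using subspace_carrier by (rule_tac subspace_diff)

lemma carrier_add: "x \<in> X \<Longrightarrow> y \<in> X \<Longrightarrow> x + y \<in> X"
  using subspace_carrier by (rule_tac subspace_add)

lemma carrier_scale: "x \<in> X \<Longrightarrow> c \<cdot> x \<in> X"
  using subspace_carrier by (rule_tac subspace_scale)

lemma carrier_0: "0 \<in> X"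
  using subspace_carrier by (rule subspace_0)

lemma ndist_eq: "x \<in> X \<Longrightarrow> y \<in> X \<Longrightarrow> ndist x y = nrm (x - y)"
  by (simp add: ndist_def)

lemma nrm_minus_commute: "x \<in> X \<Longrightarrow> y \<in> X \<Longrightarrow> nrm (x - y) = nrm (y - x)"
  by (metis metric.commute ndist_eq)

lemma nrm_diff_le: "x \<in> X \<Longrightarrow> y \<in> X \<Longrightarrow> nrm x \<le> nrm y + nrm (x - y)"
  using nrm_triangle[of y "x - y"] by (simp add: carrier_diff)

lemma mball_0: "metric.mball 0 c = {x \<in> X. nrm x < c}"
  using nrm_scale[of _ "- 1"] carrier_0 by (auto simp: metric.in_mball ndist_def)

lemma continuous_map_nrm: "continuous_map metric.mtopology euclideanreal nrm"
  unfolding metric.continuous_map_from_metric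
proof (intro conjI ballI allI impI)
  fix a U assume a: "a \<in> X" and U: "openin euclideanreal U \<and> nrm a \<in> U"
  then obtain e where e: "0 < e" "\<And>t. \<bar>t - nrm a\<bar> < e \<Longrightarrow> t \<in> U"
    by (auto simp: open_dist dist_real_def)
  have "\<bar>nrm x - nrm a\<bar> \<le> ndist a x" if "x \<in> X" for x
    using nrm_diff_le[OF a that] nrm_diff_le[OF that a] nrm_minus_commute[OF a that]
    by (simp add: ndist_eq a that)
  then show "\<exists>r>0. \<forall>x. x \<in> X \<and> ndist a x < r \<longrightarrow> nrm x \<in> U"
    using e by (intro exI[of _ e]) force
qed simp

text \<open>
  Both the radii of the ball and the circles in the definition of plurisubharmonicity are curves of
  this kind.
\<close>

lemma continuous_map_affine:
  fixes c :: "'t::metric_space \<Rightarrow> complex"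
  assumes a: "a \<in> X" and b: "b \<in> X" and c: "continuous_on S c"
  shows "continuous_map (top_of_set S) metric.mtopology (\<lambda>t. a + c t \<cdot> b)"
  unfolding metric.continuous_map_to_metric
proof (intro ballI allI impI)
  fix t and \<epsilon> :: real assume "t \<in> topspace (top_of_set S)" and \<epsilon>: "0 < \<epsilon>"
  then have t: "t \<in> S" by simp
  have "0 \<le> nrm b" by (rule nrm_nonneg[OF b])
  then have pos: "0 < \<epsilon> / (nrm b + 1)"
    using \<epsilon> by simp
  define U where "U = S \<inter> c -` ball (c t) (\<epsilon> / (nrm b + 1))"
  have "openin (top_of_set S) U"
    unfolding U_def by (rule continuous_openin_preimage_gen[OF c]) simp
  moreover have "t \<in> U"
    using t pos by (simp add: U_def)
  moreover have "a + c s \<cdot> b \<in> metric.mball (a + c t \<cdot> b) \<epsilon>" if "s \<in> U" for s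
  proof -
    have "nrm ((a + c t \<cdot> b) - (a + c s \<cdot> b)) = cmod (c t - c s) * nrm b"
      by (simp add: nrm_scale[OF b] flip: scale_left_diff_distrib)
    also have "\<dots> \<le> \<epsilon> / (nrm b + 1) * nrm b"
      using that \<open>0 \<le> nrm b\<close> by (intro mult_right_mono) (auto simp: U_def dist_norm)
    also have "\<dots> < \<epsilon>"
      using \<epsilon> \<open>0 \<le> nrm b\<close> by (simp add: field_simps)
    finally show ?thesis
      using a b by (simp add: metric.in_mball ndist_eq carrier_add carrier_scale)
  qed
  ultimately show "\<exists>U. openin (top_of_set S) U \<and> t \<in> U \<and>
      (\<forall>s\<in>U. a + c s \<cdot> b \<in> metric.mball (a + c t \<cdot> b) \<epsilon>)"
    by blast
qed

text \<open>
  Connectedness: the ball is the union of its radii, which all contain \<open>0\<close>.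
\<close>

lemma bounded_domain_open_unit_ball: "bounded_domain open_unit_ball"
proof -
  have ball: "open_unit_ball = metric.mball 0 1"
    by (simp add: open_unit_ball_def mball_0)
  have zero: "0 \<in> open_unit_ball"
    using nrm_eq_0 by (simp add: ball carrier_0)
  have "connectedin metric.mtopology open_unit_ball"
  proof -
    define segment where "segment x = (\<lambda>t. 0 + complex_of_real t \<cdot> x) ` {0..1}" for x
    have union: "open_unit_ball = \<Union> (segment ` open_unit_ball)"
    proof (intro equalityI subsetI)
      fix x assume "x \<in> open_unit_ball"
      moreover have "x \<in> segment x"
        by (auto simp: segment_def intro!: image_eqI[of _ _ 1])
      ultimately show "x \<in> \<Union> (segment ` open_unit_ball)" by blast
    next
      fix y assume "y \<in> \<Union> (segment ` open_unit_ball)"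
      then obtain x t where x: "x \<in> X" "nrm x < 1" and t: "0 \<le> t" "t \<le> 1"
        and y: "y = complex_of_real t \<cdot> x"
        by (auto simp: segment_def open_unit_ball_def)
      have "t * nrm x \<le> 1 * nrm x"
        using t nrm_nonneg[OF x(1)] by (intro mult_right_mono) auto
      then show "y \<in> open_unit_ball"
        using x t by (simp add: y open_unit_ball_def carrier_scale nrm_scale)
    qed
    show ?thesis
    proof (subst union, rule connectedin_Union)
      fix S assume "S \<in> segment ` open_unit_ball"
      then obtain x where x: "x \<in> X" and S: "S = segment x"
        by (auto simp: open_unit_ball_def)
      have "continuous_map (top_of_set {0..1}) metric.mtopology (\<lambda>t. 0 + complex_of_real t \<cdot> x)"
        by (intro continuous_map_affine carrier_0 x continuous_intros)
      moreover have "connectedin (top_of_set {0..1::real}) {0..1}"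
        by (simp add: connectedin_subtopology)
      ultimately show "connectedin metric.mtopology S"
        unfolding S segment_def by (rule connectedin_continuous_map_image)
    next
      have "0 \<in> segment x" for x
        by (auto simp: segment_def intro!: image_eqI[of _ _ 0])
      then show "\<Inter> (segment ` open_unit_ball) \<noteq> {}"
        by blast
    qed
  qed
  moreover have "open_unit_ball \<noteq> {}"
    using zero by blast
  ultimately show ?thesis
    unfolding bounded_domain_def by (simp add: ball)
qed

lemma frontier_of_open_unit_ball:
  assumes "w \<in> metric.mtopology frontier_of open_unit_ball"
  shows "w \<in> X" "nrm w = 1"
proof -
  have "openin metric.mtopology open_unit_ball"
    by (simp add: open_unit_ball_def flip: mball_0)
  then have "w \<notin> open_unit_ball"
    using assms by (simp add: frontier_of_def interior_of_openin)
  moreover show w: "w \<in> X"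
    using assms frontier_of_subset_topspace[of metric.mtopology] by auto
  moreover have "nrm w \<le> 1"
  proof -
    have "closedin metric.mtopology {x \<in> topspace metric.mtopology. nrm x \<in> {..1}}"
      by (rule closedin_continuous_map_preimage[OF continuous_map_nrm]) simp
    then have "metric.mtopology closure_of open_unit_ball \<subseteq> {x \<in> X. nrm x \<le> 1}"
      by (intro closure_of_minimal) (auto simp: open_unit_ball_def)
    then show ?thesis
      using assms by (auto simp: frontier_of_def)
  qed
  ultimately show "nrm w = 1"
    by (auto simp: open_unit_ball_def)
qed

lemma eventually_nrm_powr_le:
  assumes "x \<in> X" "0 < \<alpha>" "0 < \<epsilon>"
  shows "\<forall>\<^sub>F y in atin metric.mtopology x. y \<in> X \<and> C * nrm (y - x) powr \<alpha> \<le> \<epsilon>"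
proof -
  define d where "d = (\<epsilon> / (\<bar>C\<bar> + 1)) powr (1 / \<alpha>)"
  have "C * nrm (y - x) powr \<alpha> \<le> \<epsilon>" if y: "y \<in> X" "ndist y x < d" for y
  proof -
    have "nrm (y - x) powr \<alpha> \<le> d powr \<alpha>"
      using assms y by (intro powr_mono2) (auto simp: ndist_eq nrm_nonneg carrier_diff)
    also have "\<dots> = \<epsilon> / (\<bar>C\<bar> + 1)"
      using assms by (simp add: d_def powr_powr)
    finally have "(\<bar>C\<bar> + 1) * nrm (y - x) powr \<alpha> \<le> \<epsilon>"
      by (simp add: field_simps)
    moreover have "C * nrm (y - x) powr \<alpha> \<le> (\<bar>C\<bar> + 1) * nrm (y - x) powr \<alpha>"
      by (intro mult_right_mono) auto
    ultimately show ?thesis by linarith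
  qed
  moreover have "0 < d"
    using assms by (simp add: d_def)
  ultimately show ?thesis
    unfolding metric.eventually_atin_metric by blast
qed

text \<open>
  Reduces continuous differentiability to two explicit estimates, which for a sum over coordinates
  can be proved termwise: every \<open>\<epsilon>\<close> in the definition is met once \<open>C \<parallel>y - x\<parallel>\<^sup>\<alpha> \<le> \<epsilon>\<close>, or
  \<open>(B + 1) \<parallel>y - x\<parallel> \<le> \<epsilon>\<close> for the continuity of \<open>f\<close> itself.
\<close>

lemma holder_gradient_imp_C1:
  assumes \<alpha>: "0 < \<alpha>"
    and linear: "\<And>x u v s t. \<lbrakk>x \<in> X; u \<in> X; v \<in> X\<rbrakk> \<Longrightarrow>
        D x (of_real s \<cdot> u + of_real t \<cdot> v) = s * D x u + t * D x v"
    and bounded: "\<And>x. x \<in> X \<Longrightarrow> \<exists>B. \<forall>h\<in>X. \<bar>D x h\<bar> \<le> B * nrm h"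
    and taylor: "\<And>x y. \<lbrakk>x \<in> X; y \<in> X\<rbrakk> \<Longrightarrow>
        \<bar>f y - f x - D x (y - x)\<bar> \<le> C * nrm (y - x) powr \<alpha> * nrm (y - x)"
    and holder: "\<And>x y h. \<lbrakk>x \<in> X; y \<in> X; h \<in> X\<rbrakk> \<Longrightarrow>
        \<bar>D y h - D x h\<bar> \<le> C * nrm (y - x) powr \<alpha> * nrm h"
  shows "C_on 1 X f" and "x \<in> X \<Longrightarrow> has_frechet_derivative f (D x) x"
proof -
  have small: "\<forall>\<^sub>F y in atin metric.mtopology x. y \<in> X \<and> \<bar>f y - f x - D x (y - x)\<bar> \<le> \<epsilon> * nrm (y - x)"
    if x: "x \<in> X" and "0 < \<epsilon>" for x \<epsilon>
    using eventually_nrm_powr_le[OF x \<alpha> \<open>0 < \<epsilon>\<close>, of C]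
  proof eventually_elim
    case (elim y)
    then have "C * nrm (y - x) powr \<alpha> * nrm (y - x) \<le> \<epsilon> * nrm (y - x)"
      using x by (intro mult_right_mono) (auto simp: nrm_nonneg carrier_diff)
    then show ?case
      using taylor[OF x, of y] elim by simp
  qed
  have continuous: "\<forall>\<^sub>F y in atin metric.mtopology x. \<bar>f y - f x\<bar> \<le> \<epsilon>"
    if x: "x \<in> X" and \<epsilon>: "0 < \<epsilon>" for x \<epsilon>
  proof -
    obtain B where B: "\<And>h. h \<in> X \<Longrightarrow> \<bar>D x h\<bar> \<le> B * nrm h"
      using bounded[OF x] by blast
    show ?thesis
      using small[OF x zero_less_one] eventually_nrm_powr_le[OF x zero_less_one \<epsilon>, of "B + 1"]
    proof eventually_elim
      case (elim y)
      then have "\<bar>f y - f x\<bar> \<le> (B + 1) * nrm (y - x)"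
        using B[of "y - x"] x by (simp add: carrier_diff algebra_simps)
      also have "\<dots> \<le> \<epsilon>"
        using elim x by (simp add: nrm_nonneg carrier_diff)
      finally show ?case .
    qed
  qed
  \<comment> \<open>Derivatives of order greater than one do not enter, so one formula serves all positive orders.\<close>
  define E where "E k x hs = (if k = 0 then f x else D x (hd hs))" for k :: nat and x hs
  have multilinear: "bounded_multilinear k (E k x)" if k: "k \<le> 1" and x: "x \<in> X" for k x
  proof -
    obtain B where B: "\<And>h. h \<in> X \<Longrightarrow> \<bar>D x h\<bar> \<le> B * nrm h"
      using bounded[OF x] by blast
    consider "k = 0" | "k = 1" using k by linarith
    then show ?thesis
    proof cases
      case 1
      then show ?thesis
        by (auto simp: bounded_multilinear_def E_def)
    next
      case 2
      have "\<exists>C. \<forall>hs\<in>lists X. length hs = 1 \<longrightarrow> \<bar>E 1 x hs\<bar> \<le> C * prod_list (map nrm hs)"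
        using B by (intro exI[of _ B]) (auto simp: E_def length_Suc_conv)
      then show ?thesis
        using 2 linear[OF x] by (simp add: bounded_multilinear_def E_def)
    qed
  qed
  show "C_on 1 X f"
    unfolding C_on_def
  proof (intro exI[of _ E] conjI allI impI ballI)
    fix x assume "x \<in> X"
    show "E 0 x [] = f x" by (simp add: E_def)
  next
    fix k x assume "k \<le> (1::nat)" "x \<in> X"
    then show "bounded_multilinear k (E k x)" by (rule multilinear)
  next
    fix k :: nat and x and \<epsilon> :: real assume "k < 1" "x \<in> X" "0 < \<epsilon>"
    with small[of x \<epsilon>]
    show "\<forall>\<^sub>F y in atin metric.mtopology x. \<forall>hs\<in>lists X. length hs = k \<longrightarrow>
       \<bar>E k y hs - E k x hs - E (Suc k) x ((y - x) # hs)\<bar> \<le> \<epsilon> * nrm (y - x) * prod_list (map nrm hs)"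
      by (auto simp: E_def elim: eventually_mono)
  next
    fix k :: nat and x and \<epsilon> :: real assume k: "k \<le> 1" and x: "x \<in> X" and \<epsilon>: "0 < \<epsilon>"
    show "\<forall>\<^sub>F y in atin metric.mtopology x. \<forall>hs\<in>lists X. length hs = k \<longrightarrow>
       \<bar>E k y hs - E k x hs\<bar> \<le> \<epsilon> * prod_list (map nrm hs)"
    proof (cases "k = 0")
      case True
      then show ?thesis using continuous[OF x \<epsilon>] by (auto simp: E_def elim: eventually_mono)
    next
      case False
      then have k: "k = Suc 0" using k by simp
      show ?thesis
        using eventually_nrm_powr_le[OF x \<alpha> \<epsilon>, of C]
      proof eventually_elim
        case (elim y)
        have "\<bar>D y h - D x h\<bar> \<le> \<epsilon> * nrm h" if h: "h \<in> X" for h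
        proof -
          have "\<bar>D y h - D x h\<bar> \<le> C * nrm (y - x) powr \<alpha> * nrm h"
            using elim x h by (intro holder) auto
          also have "\<dots> \<le> \<epsilon> * nrm h"
            using elim nrm_nonneg[OF h] by (intro mult_right_mono) auto
          finally show ?thesis .
        qed
        then show ?case by (auto simp: E_def k length_Suc_conv)
      qed
    qed
  qed
  show "has_frechet_derivative f (D x) x" if x: "x \<in> X"
    unfolding has_frechet_derivative_def
  proof (intro conjI ballI allI bounded[OF x] linear[OF x] tendstoI)
    fix \<epsilon> :: real assume \<epsilon>: "0 < \<epsilon>"
    then have "0 < \<epsilon> / 2" by simp
    from small[OF x this]
    show "\<forall>\<^sub>F y in atin metric.mtopology x. dist ((f y - f x - D x (y - x)) / nrm (y - x)) 0 < \<epsilon>"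
    proof eventually_elim
      case (elim y)
      have n: "0 \<le> nrm (y - x)"
        using elim x by (simp add: nrm_nonneg carrier_diff)
      show ?case
      proof (cases "nrm (y - x) = 0")
        case False
        then have "\<bar>f y - f x - D x (y - x)\<bar> / nrm (y - x) \<le> \<epsilon> / 2"
          using elim n by (simp add: divide_le_eq)
        then have "\<bar>f y - f x - D x (y - x)\<bar> / nrm (y - x) < \<epsilon>"
          using \<epsilon> by linarith
        then show ?thesis
          using n by (simp add: dist_real_def)
      qed (use \<epsilon> in simp)
    qed
  qed
qed

lemma C_on_subset: "C_on l V f \<Longrightarrow> W \<subseteq> V \<Longrightarrow> C_on l W f"
  unfolding C_on_def by (elim ex_forward conj_forward all_forward imp_forward; meson subsetD)

lemma C_on_imp_continuous_map:
  assumes "C_on l X f"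
  shows "continuous_map metric.mtopology euclideanreal f"
  unfolding metric.continuous_map_from_metric
proof (intro conjI ballI allI impI)
  fix a U assume a: "a \<in> X" and U: "openin euclideanreal U \<and> f a \<in> U"
  then obtain e where e: "0 < e" "\<And>t. \<bar>t - f a\<bar> < e \<Longrightarrow> t \<in> U"
    by (auto simp: open_dist dist_real_def)
  obtain D :: "nat \<Rightarrow> 'a \<Rightarrow> 'a list \<Rightarrow> real" where D: "\<forall>x\<in>X. D 0 x [] = f x"
    and near: "\<forall>k\<le>l. \<forall>x\<in>X. \<forall>\<epsilon>>0. \<forall>\<^sub>F y in atin metric.mtopology x.
      \<forall>hs\<in>lists X. length hs = k \<longrightarrow> \<bar>D k y hs - D k x hs\<bar> \<le> \<epsilon> * prod_list (map nrm hs)"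
    using assms unfolding C_on_def by (elim exE conjE) (rule that)
  have "\<forall>\<^sub>F y in atin metric.mtopology a. \<forall>hs\<in>lists X. length hs = 0 \<longrightarrow>
      \<bar>D 0 y hs - D 0 a hs\<bar> \<le> e / 2 * prod_list (map nrm hs)"
    using near[THEN spec, THEN mp, THEN bspec[OF _ a], THEN spec[of _ "e / 2"], of 0] e(1)
    by (simp only: le0 half_gt_zero)
  then have "\<forall>\<^sub>F y in atin metric.mtopology a. \<bar>D 0 y [] - D 0 a []\<bar> \<le> e / 2"
    by (rule eventually_mono) simp
  then obtain d where d: "0 < d"
    and "\<And>y. \<lbrakk>y \<in> X; 0 < ndist y a; ndist y a < d\<rbrakk> \<Longrightarrow> \<bar>D 0 y [] - D 0 a []\<bar> \<le> e / 2"
    using a unfolding metric.eventually_atin_metric by blast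
  then have close: "\<bar>f y - f a\<bar> < e" if "y \<in> X" "0 < ndist y a" "ndist y a < d" for y
    using that a e(1) D by fastforce
  have "\<bar>f y - f a\<bar> < e" if "y \<in> X" "ndist a y < d" for y
  proof (cases "y = a")
    case False
    then show ?thesis
      using that a close[of y] metric.mdist_pos_less[of y a] metric.commute[of a y] by simp
  qed (use e in simp)
  then show "\<exists>r>0. \<forall>x. x \<in> X \<and> ndist a x < r \<longrightarrow> f x \<in> U"
    using e d by blast
qed simp

lemma upper_semicontinuous_on_continuous:
  assumes "continuous_map metric.mtopology euclideanreal f" "V \<subseteq> X"
  shows "upper_semicontinuous_on V (\<lambda>x. ereal (f x))"
proof -
  have "open (ereal -` {..<c})" for c
    by (simp add: open_ereal_vimage)
  then show ?thesis
    using openin_subtopology_preimage[OF assms(1), of V "ereal -` {..<c}" for c] assms(2)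
    by (simp add: upper_semicontinuous_on_def)
qed

lemma lower_semicontinuous_on_continuous:
  assumes "continuous_map metric.mtopology euclideanreal f" "V \<subseteq> X"
  shows "lower_semicontinuous_on V f"
  using openin_subtopology_preimage[OF assms(1), of V "{c<..}" for c] assms(2)
  by (simp add: lower_semicontinuous_on_def)

end

section \<open>The \<open>p\<close>-th power of the norm of \<open>\<ell>\<^sub>p\<close>\<close>

lemma lp_norm_powr_sums:
  assumes "1 \<le> p" "x \<in> lp_space p"
  shows "(\<lambda>n. cmod (x n) powr p) sums lp_norm p x powr p"
  using assms by (simp add: lp_norm_powr lp_space_def summable_sums)

lemma lp_space_diff:
  assumes "1 \<le> p" "x \<in> lp_space p" "y \<in> lp_space p"
  shows "x - y \<in> lp_space p"
  using complex_normed_space.carrier_diff[OF lp_complex_normed_space[OF assms(1)]] assms by blast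

lemma abs_suminf_le_of_sums:
  fixes f g :: "nat \<Rightarrow> real"
  assumes "\<And>n. \<bar>f n\<bar> \<le> g n" and g: "g sums s"
  shows "summable f" "\<bar>suminf f\<bar> \<le> s"
proof -
  show "summable f"
    using assms by (intro summable_comparison_test'[of g 0 f]) (auto simp: sums_iff)
  show "\<bar>suminf f\<bar> \<le> s"
    using norm_suminf_le[of f g] assms by (auto simp: sums_iff)
qed

text \<open>
  Hoelder's inequality for \<open>p\<close> and its dual exponent: Young's inequality is applied to each coordinate
  of the normalised sequences, and the right-hand sides add up to \<open>p\<close>.
\<close>

lemma lp_holder:
  assumes p: "1 < p" and u: "u \<in> lp_space p" and h: "h \<in> lp_space p"
  shows "summable (\<lambda>n. cmod (u n) powr (p - 1) * cmod (h n))"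
    and "(\<Sum>n. cmod (u n) powr (p - 1) * cmod (h n)) \<le> lp_norm p u powr (p - 1) * lp_norm p h"
proof -
  define A B where "A = lp_norm p u" and "B = lp_norm p h"
  define f where "f n = cmod (u n) powr (p - 1) * cmod (h n)" for n
  have "summable f \<and> suminf f \<le> A powr (p - 1) * B"
  proof (cases "A = 0 \<or> B = 0")
    case True
    then have "f = (\<lambda>n. 0)"
      using lp_norm_eq_0[of p u] lp_norm_eq_0[of p h] p u h by (auto simp: A_def B_def f_def)
    then show ?thesis by (simp add: A_def B_def lp_norm_nonneg)
  next
    case False
    then have AB: "0 < A" "0 < B"
      using lp_norm_nonneg[of p u] lp_norm_nonneg[of p h] by (auto simp: A_def B_def)
    have norm1: "(\<lambda>n. (cmod (z n) / c) powr p) sums 1"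
      if "c = lp_norm p z" "0 < c" "z \<in> lp_space p" for z c
      using sums_divide[OF lp_norm_powr_sums[OF _ that(3)], of "c powr p"] that p
      by (simp add: powr_divide)
    define g where "g n = A powr (p - 1) * B / p *
      ((cmod (h n) / B) powr p + (p - 1) * (cmod (u n) / A) powr p)" for n
    have "g sums (A powr (p - 1) * B / p * (1 + (p - 1) * 1))"
      unfolding g_def using AB u h
      by (intro sums_mult sums_add norm1) (auto simp: A_def B_def)
    then have "g sums (A powr (p - 1) * B)"
      using p by simp
    moreover have "\<bar>f n\<bar> \<le> g n" for n
    proof -
      have "f n = A powr (p - 1) * B / p * (p * (cmod (u n) / A) powr (p - 1) * (cmod (h n) / B))"
        using AB p by (simp add: f_def powr_divide)
      also have "\<dots> \<le> g n"
        unfolding g_def using AB p by (intro mult_left_mono young_powr) auto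
      finally show ?thesis by (simp add: f_def)
    qed
    ultimately show ?thesis
      using abs_suminf_le_of_sums[of f g "A powr (p - 1) * B"] by auto
  qed
  then show "summable (\<lambda>n. cmod (u n) powr (p - 1) * cmod (h n))"
    and "(\<Sum>n. cmod (u n) powr (p - 1) * cmod (h n)) \<le> lp_norm p u powr (p - 1) * lp_norm p h"
    by (simp_all add: A_def B_def f_def[abs_def])
qed

text \<open>
  Both the derivative of \<open>\<parallel>x\<parallel>\<^sup>p\<close> and its increments are functionals \<open>h \<mapsto> \<Sum>n. c\<^sub>n \<bullet> h\<^sub>n\<close> whose coefficients
  are of the size \<open>\<bar>u\<^sub>n\<bar>\<^sup>p\<^sup>-\<^sup>1\<close> for some \<open>u \<in> \<ell>\<^sub>p\<close>.
\<close>

lemma lp_functional_bound: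
  assumes p: "1 < p" and u: "u \<in> lp_space p" and h: "h \<in> lp_space p"
    and c: "\<And>n. norm (c n) \<le> K * cmod (u n) powr (p - 1)"
    and K: "0 \<le> K"
  shows "summable (\<lambda>n. c n \<bullet> h n)"
    and "\<bar>\<Sum>n. c n \<bullet> h n\<bar> \<le> K * lp_norm p u powr (p - 1) * lp_norm p h"
proof -
  define g where "g n = K * (cmod (u n) powr (p - 1) * cmod (h n))" for n
  have "\<bar>c n \<bullet> h n\<bar> \<le> g n" for n
  proof -
    have "\<bar>c n \<bullet> h n\<bar> \<le> norm (c n) * cmod (h n)"
      by (rule Cauchy_Schwarz_ineq2)
    also have "\<dots> \<le> K * cmod (u n) powr (p - 1) * cmod (h n)"
      by (intro mult_right_mono c) simp
    finally show ?thesis by (simp add: g_def mult.assoc)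
  qed
  moreover have "g sums (K * (\<Sum>n. cmod (u n) powr (p - 1) * cmod (h n)))"
    unfolding g_def by (intro sums_mult summable_sums lp_holder p u h)
  ultimately have *: "summable (\<lambda>n. c n \<bullet> h n)"
      "\<bar>\<Sum>n. c n \<bullet> h n\<bar> \<le> K * (\<Sum>n. cmod (u n) powr (p - 1) * cmod (h n))"
    by (rule abs_suminf_le_of_sums)+
  show "summable (\<lambda>n. c n \<bullet> h n)" by fact
  show "\<bar>\<Sum>n. c n \<bullet> h n\<bar> \<le> K * lp_norm p u powr (p - 1) * lp_norm p h"
    using *(2) mult_left_mono[OF lp_holder(2)[OF p u h] K] by (simp add: mult.assoc)
qed

definition lp_powr_derivative :: "real \<Rightarrow> (nat \<Rightarrow> complex) \<Rightarrow> (nat \<Rightarrow> complex) \<Rightarrow> real" where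
  "lp_powr_derivative p x h = (\<Sum>n. powr_gradient p (x n) \<bullet> h n)"

lemma lp_powr_derivative_bound:
  assumes p: "1 < p" and x: "x \<in> lp_space p" and h: "h \<in> lp_space p"
  shows "summable (\<lambda>n. powr_gradient p (x n) \<bullet> h n)"
    and "\<bar>lp_powr_derivative p x h\<bar> \<le> p * lp_norm p x powr (p - 1) * lp_norm p h"
  using lp_functional_bound[OF p x h, of "\<lambda>n. powr_gradient p (x n)" p] p
  by (simp_all add: norm_powr_gradient lp_powr_derivative_def)

lemma lp_powr_derivative_linear:
  assumes p: "1 < p" and x: "x \<in> lp_space p" and u: "u \<in> lp_space p" and v: "v \<in> lp_space p"
  shows "lp_powr_derivative p x (seq_scale (of_real s) u + seq_scale (of_real t) v)
    = s * lp_powr_derivative p x u + t * lp_powr_derivative p x v"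
proof -
  note sums = lp_powr_derivative_bound(1)[OF p x, THEN summable_sums]
  have "(\<lambda>n. s * (powr_gradient p (x n) \<bullet> u n) + t * (powr_gradient p (x n) \<bullet> v n))
      sums (s * lp_powr_derivative p x u + t * lp_powr_derivative p x v)"
    unfolding lp_powr_derivative_def by (intro sums_add sums_mult sums u v)
  then show ?thesis
    by (simp add: lp_powr_derivative_def sums_iff seq_scale_def inner_add_right
        flip: scaleR_conv_of_real)
qed

lemma lp_powr_derivative_self:
  assumes "1 < p" "x \<in> lp_space p"
  shows "lp_powr_derivative p x x = p * lp_norm p x powr p"
  using sums_mult[OF lp_norm_powr_sums[of p x], of p] assms
  by (simp add: lp_powr_derivative_def powr_gradient_inner_self sums_iff)

lemma lp_powr_derivative_holder:
  assumes p: "1 < p" "p \<le> 2"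
    and x: "x \<in> lp_space p" and y: "y \<in> lp_space p" and h: "h \<in> lp_space p"
  shows "\<bar>lp_powr_derivative p y h - lp_powr_derivative p x h\<bar>
    \<le> 3 * p * lp_norm p (y - x) powr (p - 1) * lp_norm p h"
proof -
  have "lp_powr_derivative p y h - lp_powr_derivative p x h
      = (\<Sum>n. (powr_gradient p (y n) - powr_gradient p (x n)) \<bullet> h n)"
    using suminf_diff[OF lp_powr_derivative_bound(1)[OF p(1) y h] lp_powr_derivative_bound(1)[OF p(1) x h]]
    by (simp add: lp_powr_derivative_def inner_diff_left)
  moreover have "\<bar>\<Sum>n. (powr_gradient p (y n) - powr_gradient p (x n)) \<bullet> h n\<bar>
      \<le> 3 * p * lp_norm p (y - x) powr (p - 1) * lp_norm p h"
    using p powr_gradient_holder[OF p]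
    by (intro lp_functional_bound(2) lp_space_diff x y h) auto
  ultimately show ?thesis by simp
qed

lemma lp_powr_taylor:
  assumes p: "1 < p" "p \<le> 2" and x: "x \<in> lp_space p" and y: "y \<in> lp_space p"
  shows "\<bar>lp_norm p y powr p - lp_norm p x powr p - lp_powr_derivative p x (y - x)\<bar>
    \<le> 3 * p * lp_norm p (y - x) powr (p - 1) * lp_norm p (y - x)"
proof -
  have yx: "y - x \<in> lp_space p"
    using p by (intro lp_space_diff x y) auto
  define f where
    "f n = cmod (y n) powr p - cmod (x n) powr p - powr_gradient p (x n) \<bullet> (y n - x n)" for n
  have "f sums (lp_norm p y powr p - lp_norm p x powr p - lp_powr_derivative p x (y - x))"
    unfolding f_def lp_powr_derivative_def
    using p summable_sums[OF lp_powr_derivative_bound(1)[OF p(1) x yx]]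
    by (intro sums_diff lp_norm_powr_sums x y) auto
  moreover have "(\<lambda>n. 3 * p * cmod ((y - x) n) powr p) sums (3 * p * lp_norm p (y - x) powr p)"
    using p by (intro sums_mult lp_norm_powr_sums yx) auto
  then have "\<bar>suminf f\<bar> \<le> 3 * p * lp_norm p (y - x) powr p"
    by (intro abs_suminf_le_of_sums(2)[of f]) (use norm_powr_taylor[OF p] in \<open>auto simp: f_def\<close>)
  ultimately show ?thesis
    using powr_mult_base[of "lp_norm p (y - x)" "p - 1"]
    by (simp add: sums_iff lp_norm_nonneg mult_ac)
qed

text \<open>
  The one-coordinate inequalities are summed, after the weighted squares in them have been replaced by
  the lower bound that is linear in \<open>p\<close>-th powers. The resulting constant is the one for a single
  coordinate.
\<close>

lemma lp_norm_powr_midpoint_gap: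
  assumes p: "1 < p" "p \<le> 2" and a: "a \<in> lp_space p" and u: "u \<in> lp_space p"
    and W: "lp_norm p a + lp_norm p u \<le> W" "0 < W"
  shows "lp_norm p a powr p + p * (p - 1) / 2 * W powr (p - 2) * (lp_norm p u)\<^sup>2
    \<le> (lp_norm p (a + u) powr p + lp_norm p (a - u) powr p) / 2"
proof -
  define A U where "A = lp_norm p a" and "U = lp_norm p u"
  \<comment> \<open>For this scale the sum of \<open>\<rho>\<^sup>p w\<^sub>n\<^sup>p\<close> is at most \<open>\<rho>\<^sup>p W\<^sup>p = U\<^sup>p\<close>.\<close>
  define \<rho> where "\<rho> = U / W"
  define w where "w n = cmod (a n) + cmod (u n)" for n
  have p1: "1 \<le> p" using p by simp
  have nn: "0 \<le> U" by (simp add: U_def lp_norm_nonneg)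
  obtain S where S: "(\<lambda>n. w n powr p) sums S" and SW: "S \<le> W powr p"
  proof -
    define modulus where "modulus x = (\<lambda>n. complex_of_real (cmod (x n)))" for x :: "nat \<Rightarrow> complex"
    have mod: "modulus x \<in> lp_space p" "lp_norm p (modulus x) = lp_norm p x"
      if "x \<in> lp_space p" for x
      using that by (simp_all add: modulus_def lp_space_def lp_norm_def)
    have "cmod ((modulus a + modulus u) n) = w n" for n
      by (simp add: modulus_def w_def flip: of_real_add)
    then have "(\<lambda>n. w n powr p) sums lp_norm p (modulus a + modulus u) powr p"
      using lp_norm_powr_sums[OF p1 lp_add(1)[OF p1 mod(1)[OF a] mod(1)[OF u]]] by simp
    moreover have "lp_norm p (modulus a + modulus u) powr p \<le> W powr p"
      using lp_add(2)[OF p1 mod(1)[OF a] mod(1)[OF u]] W p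
      by (intro powr_mono2) (auto simp: mod a u lp_norm_nonneg)
    ultimately show ?thesis by (rule that)
  qed
  show ?thesis
  proof (cases "U = 0")
    case True
    then have "u = 0" using lp_norm_eq_0[OF p1 u] by (simp add: U_def)
    then show ?thesis using True by (simp add: U_def lp_zero)
  next
    case False
    then have \<rho>: "0 < \<rho>" using nn W by (simp add: \<rho>_def)
    \<comment> \<open>c is the product of p (p - 1) / 2 from the one-coordinate inequality and of the factor
      from the bound for the weighted square.\<close>
    define c where "c = (p - 1) * \<rho> powr (2 - p)"
    have c: "0 \<le> c" using p by (simp add: c_def)
    define f where "f n = cmod (a n) powr p + c * (cmod (u n) powr p
      - (1 - p / 2) * \<rho> powr p * w n powr p)" for n
    have "f sums (A powr p + c * (U powr p - (1 - p / 2) * \<rho> powr p * S))"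
      unfolding f_def A_def U_def by (intro sums_add sums_mult sums_diff lp_norm_powr_sums p1 a u S)
    moreover have "(\<lambda>n. (cmod ((a + u) n) powr p + cmod ((a - u) n) powr p) / 2) sums
        ((lp_norm p (a + u) powr p + lp_norm p (a - u) powr p) / 2)"
      by (intro sums_divide sums_add lp_norm_powr_sums p1 lp_add lp_space_diff a u)
    moreover have "f n \<le> (cmod ((a + u) n) powr p + cmod ((a - u) n) powr p) / 2" for n
    proof -
      have "p * (p - 1) / 2 * (\<rho> powr (2 - p) * (2 / p) * (cmod (u n) powr p - (1 - p / 2) * \<rho> powr p * w n powr p))
          \<le> p * (p - 1) / 2 * (w n powr (p - 2) * (cmod (u n))\<^sup>2)"
        using p \<rho> by (intro mult_left_mono powr_le_weighted_square) (auto simp: w_def)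
      moreover have "c * x = p * (p - 1) / 2 * (\<rho> powr (2 - p) * (2 / p) * x)" for x
        using p by (simp add: c_def)
      ultimately have "f n \<le> cmod (a n) powr p + p * (p - 1) / 2 * (w n powr (p - 2) * (cmod (u n))\<^sup>2)"
        unfolding f_def by (metis add_left_mono)
      then have "f n \<le> cmod (a n) powr p + p * (p - 1) / 2 * w n powr (p - 2) * (cmod (u n))\<^sup>2"
        by (simp only: mult.assoc)
      also have "\<dots> \<le> (cmod (a n + u n) powr p + cmod (a n - u n) powr p) / 2"
        unfolding w_def by (rule norm_powr_midpoint_gap[OF p])
      finally show ?thesis by simp
    qed
    ultimately have "A powr p + c * (U powr p - (1 - p / 2) * \<rho> powr p * S)
        \<le> (lp_norm p (a + u) powr p + lp_norm p (a - u) powr p) / 2"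
      by (rule sums_le[rotated])
    moreover have "p * (p - 1) / 2 * W powr (p - 2) * U\<^sup>2 \<le> c * (U powr p - (1 - p / 2) * \<rho> powr p * S)"
    proof -
      have "\<rho> powr p * S \<le> \<rho> powr p * W powr p"
        using SW by (intro mult_left_mono) auto
      also have "\<dots> = U powr p"
        using W nn by (simp add: \<rho>_def powr_divide)
      finally have "(1 - p / 2) * (\<rho> powr p * S) \<le> (1 - p / 2) * U powr p"
        using p by (intro mult_left_mono) auto
      then have "c * (p / 2 * U powr p) \<le> c * (U powr p - (1 - p / 2) * \<rho> powr p * S)"
        using c by (intro mult_left_mono) (auto simp: algebra_simps)
      moreover have "c * (p / 2 * U powr p) = p * (p - 1) / 2 * W powr (p - 2) * U\<^sup>2"
      proof -
        have "U powr (2 - p) * U powr p = U\<^sup>2"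
          using False nn by (simp add: powr_numeral flip: powr_add)
        moreover have "1 / W powr (2 - p) = W powr (p - 2)"
          using powr_minus_divide[of W "2 - p"] by simp
        ultimately have "\<rho> powr (2 - p) * U powr p = W powr (p - 2) * U\<^sup>2"
          using nn W by (metis \<rho>_def powr_divide times_divide_eq_left mult.commute mult_1)
        then show ?thesis by (simp add: c_def mult_ac)
      qed
      ultimately show ?thesis by (simp only:)
    qed
    ultimately show ?thesis by (simp add: A_def U_def)
  qed
qed

section \<open>The unit ball of \<open>\<ell>\<^sub>p\<close>\<close>

theorem proposition3p12:
  fixes p :: real
  assumes "1 < p" "p \<le> 2"
  shows "complex_banach_space.uniformly_pseudoconvex seq_scale (lp_space p) (lp_norm p) 1
           (complex_normed_space.open_unit_ball (lp_space p) (lp_norm p))"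
proof -
  have p1: "1 \<le> p" using assms by simp
  interpret complex_banach_space seq_scale "lp_space p" "lp_norm p"
    by (rule lp_complex_banach_space[OF p1])
  define r where "r x = lp_norm p x powr p - 1" for x
  define V where "V = metric.mball 0 2"
  define L where "L = p * (p - 1) / 2 * 2 powr (p - 2)"
  have V: "V = {x \<in> lp_space p. lp_norm p x < 2}"
    unfolding V_def by (rule mball_0)
  have openV: "openin metric.mtopology V"
    by (simp add: V_def)
  have smooth: "C_on 1 (lp_space p) r"
    and deriv: "\<And>x. x \<in> lp_space p \<Longrightarrow> has_frechet_derivative r (lp_powr_derivative p x) x"
    using assms
    by (intro holder_gradient_imp_C1[where D = "lp_powr_derivative p" and C = "3 * p" and \<alpha> = "p - 1"];
        auto simp: r_def intro!: lp_powr_derivative_linear lp_powr_derivative_holder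
          exI[of _ "p * lp_norm p x powr (p - 1)" for x] lp_powr_derivative_bound
          lp_powr_taylor)+
  note cont = C_on_imp_continuous_map[OF smooth]
  have neg: "r x < 0 \<longleftrightarrow> lp_norm p x < 1" for x
    using powr_less_mono2[of p "lp_norm p x" 1] powr_mono2[of p 1 "lp_norm p x"] assms
    by (cases "lp_norm p x < 1") (auto simp: r_def lp_norm_nonneg)
  have "defining_function 1 open_unit_ball V r"
    unfolding defining_function_def
  proof (intro conjI ballI)
    show "openin metric.mtopology V" by (rule openV)
    show "metric.mtopology frontier_of open_unit_ball \<subseteq> V"
      using frontier_of_open_unit_ball by (auto simp: V)
    show "C_on 1 V r"
      by (rule C_on_subset[OF smooth]) (auto simp: V)
    show "open_unit_ball \<inter> V = {z \<in> V. r z < 0}"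
      by (auto simp: V open_unit_ball_def neg)
    fix w assume "w \<in> metric.mtopology frontier_of open_unit_ball"
    note w = frontier_of_open_unit_ball[OF this]
    have "lp_powr_derivative p w w \<noteq> 0"
      using assms w by (simp add: lp_powr_derivative_self)
    then show "\<exists>T. has_frechet_derivative r T w \<and> (\<exists>h\<in>lp_space p. T h \<noteq> 0)"
      using deriv w by blast
  qed
  moreover have "uniformly_psh_on_average V (\<lambda>z. ereal (r z))"
    unfolding uniformly_psh_on_average_def
  proof (intro conjI ballI allI impI exI[of _ L] exI[of _ "\<lambda>a. 2 - lp_norm p a"])
    show "openin metric.mtopology V" by (rule openV)
    show "upper_semicontinuous_on V (\<lambda>z. ereal (r z))"
      by (rule upper_semicontinuous_on_continuous[OF cont]) (auto simp: V)
    show "lower_semicontinuous_on V (\<lambda>a. 2 - lp_norm p a)"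
      by (rule lower_semicontinuous_on_continuous)
        (auto simp: V intro!: continuous_map_diff continuous_map_nrm)
    show "0 < L" using assms by (simp add: L_def)
    show "0 < 2 - lp_norm p a" if "a \<in> V" for a
      using that by (simp add: V)
  next
    fix a b assume "a \<in> V" and b: "b \<in> lp_space p" and small: "lp_norm p b < 2 - lp_norm p a"
    then have a: "a \<in> lp_space p" by (simp add: V)
    show "a + seq_scale \<zeta> b \<in> V" if "cmod \<zeta> \<le> 1" for \<zeta>
    proof -
      have "lp_norm p (a + seq_scale \<zeta> b) \<le> lp_norm p a + cmod \<zeta> * lp_norm p b"
        using lp_add(2)[OF p1 a lp_scale(1)[OF p1 b]] by (simp add: lp_scale p1 b)
      also have "\<dots> \<le> lp_norm p a + 1 * lp_norm p b"
        using that by (intro add_left_mono mult_right_mono lp_norm_nonneg)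
      finally show ?thesis
        using small by (simp add: V lp_add lp_scale p1 a b)
    qed
    have "ereal (L * (lp_norm p b)\<^sup>2 + r a) \<le> circle_mean (\<lambda>\<theta>. ereal (r (a + seq_scale (cis \<theta>) b)))"
    proof (rule circle_mean_ge_antipodal)
      have "continuous_map (top_of_set {0..2 * pi}) euclideanreal (r \<circ> (\<lambda>\<theta>. a + seq_scale (cis \<theta>) b))"
        by (intro continuous_map_compose[OF _ cont] continuous_map_affine a b continuous_intros)
      then show "continuous_on {0..2 * pi} (\<lambda>\<theta>. r (a + seq_scale (cis \<theta>) b))"
        by (simp add: o_def)
      fix \<theta> :: real
      have "seq_scale (cis (\<theta> + pi)) b = - seq_scale (cis \<theta>) b"
        by (simp add: seq_scale_def fun_eq_iff cis_mult[symmetric])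
      moreover have "lp_norm p (seq_scale (cis \<theta>) b) = lp_norm p b"
        by (simp add: lp_scale p1 b)
      ultimately show "L * (lp_norm p b)\<^sup>2 + r a
          \<le> (r (a + seq_scale (cis \<theta>) b) + r (a + seq_scale (cis (\<theta> + pi)) b)) / 2"
        using lp_norm_powr_midpoint_gap[OF assms a lp_scale(1)[OF p1 b, of "cis \<theta>"], of 2] small
        by (simp add: r_def L_def)
    qed
    then show "ereal (L * (lp_norm p b)\<^sup>2) + ereal (r a)
        \<le> circle_mean (\<lambda>\<theta>. ereal (r (a + seq_scale (cis \<theta>) b)))"
      by simp
  qed simp
  ultimately show ?thesis
    unfolding uniformly_pseudoconvex_def using bounded_domain_open_unit_ball by blast
qed

end
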